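(* Let $\varphi\in L^\infty(b\Gamma)$ and let $T_\varphi$ be the corresponding Toeplitz operator on $H^2(\mathbb G)$. The following are equivalent: (i) $T_\varphi$ is an analytic Toeplitz operator; (ii) $T_\varphi$ commutes with $T_p$; (iii) $T_\varphi(\operatorname{Ran}T_p)\subseteq\operatorname{Ran}T_p$; (iv) $T_pT_\varphi$ is a Toeplitz operator; (v) $T_\varphi$ commutes with $T_s$; (vi) $T_sT_\varphi$ is a Toeplitz operator.
   Context: $\mathbb D$ is the open unit disc, $\mathbb T$ the unit circle, $m$ the product of normalized arc length measures on $\mathbb T^2=\mathbb T\times\mathbb T$. Let $\pi(z_1,z_2)=(z_1+z_2,z_1z_2)$, $J(z_1,z_2)=z_1-z_2$, $\|J\|^2=\int_{\mathbb T^2}|J|^2dm=2$, $\mathbb G=\pi(\mathbb D^2)$ and $b\Gamma=\pi(\mathbb T^2)$, with coordinates denoted $(s,p)$. Let $\nu$ be the Borel measure on $b\Gamma$ given by $\nu(E)=\int_{\pi^{-1}(E)}|J|^2dm$. $L^2(b\Gamma)$ is the Hilbert space of ($\nu$-a.e. classes of) functions on $b\Gamma$ with $\int|f|^2d\nu<\infty$, with norm $\|f\|^2=\|J\|^{-2}\int_{b\Gamma}|f|^2d\nu$; $L^\infty(b\Gamma)$ is the space of essentially bounded functions. $L^2_{\rm anti}(\mathbb T^2)=\{f\in L^2(\mathbb T^2):f(\zeta_1,\zeta_2)=-f(\zeta_2,\zeta_1)\text{ a.e.}\}$, and $U:L^2(b\Gamma)\to L^2_{\rm anti}(\mathbb T^2)$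 is the unitary $Uf=\frac1{\|J\|}J\,(f\circ\pi)$. $H^2(\mathbb G)$ is the Hilbert space of holomorphic $f$ on $\mathbb G$ with $\|f\|=\|J\|^{-1}\{\sup_{0<r<1}\int_{\mathbb T^2}|f\circ\pi(r\zeta)|^2|J(r\zeta)|^2dm(\zeta)\}^{1/2}<\infty$; via boundary values it is identified with the closed subspace of those $f\in L^2(b\Gamma)$ for which $Uf$ has Fourier coefficients supported on $\{(i,j):i,j\ge0\}$. $Pr$ is the orthogonal projection of $L^2(b\Gamma)$ onto $H^2(\mathbb G)$. For $\varphi\in L^\infty(b\Gamma)$, $M_\varphi$ is multiplication by $\varphi$ on $L^2(b\Gamma)$ and the Toeplitz operator $T_\varphi$ on $H^2(\mathbb G)$ is $T_\varphi f=Pr\,M_\varphi f$; an operator is a Toeplitz operator if it equals $T_\varphi$ for some $\varphi\in L^\infty(b\Gamma)$. $T_s$ and $T_p$ are the Toeplitz operators with the coordinate functions $s$ and $p$ as symbols. $H^\infty(\mathbb G)$ (bounded analytic functions on $\mathbb G$) is identified with its boundary functions, $H^\infty(\mathbb G)=\{\varphi\in L^\infty(b\Gamma):\varphi\circ\pi$ has Fourier coefficients supported on $\{(i,j):i,j\ge0\}\}$. $T_\varphi$ is called an analytic Toeplitz operator if $\varphi\in H^\infty(\mathbb G)$. *)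

theory Defs
  imports "HOL-Analysis.Analysis"
begin

abbreviation unit_circle :: "complex set" where
  "unit_circle \<equiv> sphere 0 1"

definition arc_measure :: "complex measure" where
  "arc_measure = distr (uniform_measure lborel {0..<2 * pi}) (restrict_space borel unit_circle) cis"

definition torus_measure :: "(complex \<times> complex) measure" where
  "torus_measure = arc_measure \<Otimes>\<^sub>M arc_measure"

definition sym_map :: "complex \<times> complex \<Rightarrow> complex \<times> complex" where
  "sym_map z = (fst z + snd z, fst z * snd z)"

definition jac :: "complex \<times> complex \<Rightarrow> complex" where
  "jac z = fst z - snd z"

definition jac_norm :: real where
  "jac_norm = sqrt (\<integral>z. (cmod (jac z))\<^sup>2 \<partial>torus_measure)"

definition bGamma :: "(complex \<times> complex) set" where
  "bGamma = sym_map ` (unit_circle \<times> unit_circle)"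

definition nu :: "(complex \<times> complex) measure" where
  "nu = distr (density torus_measure (\<lambda>z. ennreal ((cmod (jac z))\<^sup>2)))
          (restrict_space borel bGamma) sym_map"

definition fourier_coeff :: "(complex \<times> complex \<Rightarrow> complex) \<Rightarrow> int \<Rightarrow> int \<Rightarrow> complex" where
  "fourier_coeff g i j = (\<integral>z. g z * (fst z powi (- i) * snd z powi (- j)) \<partial>torus_measure)"

(* The space L^2 over bGamma, as a quotient of the square-integrable functions by equality
   nu-almost everywhere.  Representatives are functions on the whole type, whose values outside
   bGamma (the space of nu) play no role. *)

definition square_integrable :: "(complex \<times> complex \<Rightarrow> complex) \<Rightarrow> bool" where
  "square_integrable f \<longleftrightarrow> f \<in> borel_measurable nu \<and> integrable nu (\<lambda>x. (cmod (f x))\<^sup>2)"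

definition L2_rel ::
  "(complex \<times> complex \<Rightarrow> complex) \<Rightarrow> (complex \<times> complex \<Rightarrow> complex) \<Rightarrow> bool" where
  "L2_rel f g \<longleftrightarrow> square_integrable f \<and> square_integrable g \<and> (AE x in nu. f x = g x)"

lemma square_integrable_zero: "square_integrable (\<lambda>_. 0)"
  by (simp add: square_integrable_def)

lemma square_integrable_uminus: "square_integrable f \<Longrightarrow> square_integrable (\<lambda>x. - f x)"
  by (simp add: square_integrable_def)

lemma square_integrable_add:
  assumes "square_integrable f" "square_integrable g"
  shows "square_integrable (\<lambda>x. f x + g x)"
proof -
  have [measurable]: "f \<in> borel_measurable nu" "g \<in> borel_measurable nu"
    using assms by (auto simp: square_integrable_def)
  have "integrable nu (\<lambda>x. 2 * (cmod (f x))\<^sup>2 + 2 * (cmod (g x))\<^sup>2)"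
    using assms by (auto simp: square_integrable_def)
  moreover have "(cmod (f x + g x))\<^sup>2 \<le> 2 * (cmod (f x))\<^sup>2 + 2 * (cmod (g x))\<^sup>2" for x
  proof -
    have "(cmod (f x + g x))\<^sup>2 \<le> (cmod (f x) + cmod (g x))\<^sup>2"
      by (intro power_mono norm_triangle_ineq norm_ge_zero)
    also have "\<dots> \<le> 2 * (cmod (f x))\<^sup>2 + 2 * (cmod (g x))\<^sup>2"
      using sum_squares_bound[of "cmod (f x)" "cmod (g x)"] by (simp add: power2_sum)
    finally show ?thesis .
  qed
  ultimately have "integrable nu (\<lambda>x. (cmod (f x + g x))\<^sup>2)"
    by (elim Bochner_Integration.integrable_bound) auto
  then show ?thesis
    by (simp add: square_integrable_def)
qed

lemma square_integrable_diff:
  assumes "square_integrable f" "square_integrable g"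
  shows "square_integrable (\<lambda>x. f x - g x)"
  using square_integrable_add[OF assms(1) square_integrable_uminus[OF assms(2)]] by simp

quotient_type bGamma_L2 = "complex \<times> complex \<Rightarrow> complex" / partial: L2_rel
proof (rule part_equivpI)
  show "\<exists>f. L2_rel f f"
    using square_integrable_zero by (auto simp: L2_rel_def)
  show "symp L2_rel"
    by (auto simp: L2_rel_def symp_def eq_commute)
  show "transp L2_rel"
    unfolding L2_rel_def transp_def by (auto elim: eventually_elim2)
qed

instantiation bGamma_L2 :: ab_group_add
begin

lift_definition zero_bGamma_L2 :: bGamma_L2 is "\<lambda>_. 0"
  by (simp add: L2_rel_def square_integrable_zero)

lift_definition plus_bGamma_L2 :: "bGamma_L2 \<Rightarrow> bGamma_L2 \<Rightarrow> bGamma_L2" is "\<lambda>f g x. f x + g x"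
  unfolding L2_rel_def by (auto intro: square_integrable_add elim: eventually_elim2)

lift_definition uminus_bGamma_L2 :: "bGamma_L2 \<Rightarrow> bGamma_L2" is "\<lambda>f x. - f x"
  unfolding L2_rel_def by (auto intro: square_integrable_uminus)

lift_definition minus_bGamma_L2 :: "bGamma_L2 \<Rightarrow> bGamma_L2 \<Rightarrow> bGamma_L2" is "\<lambda>f g x. f x - g x"
  unfolding L2_rel_def by (auto intro: square_integrable_diff elim: eventually_elim2)

instance
  by standard
    (transfer; auto simp: L2_rel_def algebra_simps
      intro: square_integrable_add square_integrable_diff square_integrable_uminus
        square_integrable_zero)+

end

lift_definition L2_inner :: "bGamma_L2 \<Rightarrow> bGamma_L2 \<Rightarrow> complex"
  is "\<lambda>f g. (\<integral>x. f x * cnj (g x) \<partial>nu) / complex_of_real (jac_norm\<^sup>2)"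
proof -
  fix f f' g g' assume A: "L2_rel f f'" "L2_rel g g'"
  then have [measurable]: "f \<in> borel_measurable nu" "f' \<in> borel_measurable nu"
    "g \<in> borel_measurable nu" "g' \<in> borel_measurable nu"
    by (auto simp: L2_rel_def square_integrable_def)
  have [measurable]: "(\<lambda>x. cnj (g x)) \<in> borel_measurable nu" "(\<lambda>x. cnj (g' x)) \<in> borel_measurable nu"
    by (auto intro!: borel_measurable_continuous_on[of cnj] continuous_intros)
  have "(\<integral>x. f x * cnj (g x) \<partial>nu) = (\<integral>x. f' x * cnj (g' x) \<partial>nu)"
  proof (rule integral_cong_AE)
    show "AE x in nu. f x * cnj (g x) = f' x * cnj (g' x)"
      using A by (auto simp: L2_rel_def elim: eventually_elim2)
  qed measurable
  then show "(\<integral>x. f x * cnj (g x) \<partial>nu) / complex_of_real (jac_norm\<^sup>2) =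
      (\<integral>x. f' x * cnj (g' x) \<partial>nu) / complex_of_real (jac_norm\<^sup>2)"
    by simp
qed

definition L_infinity :: "(complex \<times> complex \<Rightarrow> complex) set" where
  "L_infinity = {\<phi>. \<phi> \<in> borel_measurable nu \<and> (\<exists>C. AE x in nu. cmod (\<phi> x) \<le> C)}"

(* The value 0 for a symbol outside L_infinity only makes the operation total. *)
lift_definition mult_op :: "(complex \<times> complex \<Rightarrow> complex) \<Rightarrow> bGamma_L2 \<Rightarrow> bGamma_L2"
  is "\<lambda>\<phi> f x. if \<phi> \<in> L_infinity then \<phi> x * f x else 0"
proof -
  fix \<phi> f g :: "complex \<times> complex \<Rightarrow> complex"
  assume A: "L2_rel f g"
  have B: "square_integrable (\<lambda>x. \<phi> x * f x)"
    if \<phi>: "\<phi> \<in> L_infinity" and f: "square_integrable f" for f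
  proof -
    have [measurable]: "\<phi> \<in> borel_measurable nu" "f \<in> borel_measurable nu"
      using \<phi> f by (auto simp: L_infinity_def square_integrable_def)
    obtain C where C: "AE x in nu. cmod (\<phi> x) \<le> C"
      using \<phi> by (auto simp: L_infinity_def)
    have "integrable nu (\<lambda>x. C\<^sup>2 * (cmod (f x))\<^sup>2)"
      using f by (simp add: square_integrable_def)
    moreover have "AE x in nu. norm ((cmod (\<phi> x * f x))\<^sup>2) \<le> norm (C\<^sup>2 * (cmod (f x))\<^sup>2)"
      using C
    proof eventually_elim
      case (elim x)
      then have "(cmod (\<phi> x))\<^sup>2 \<le> C\<^sup>2" by (intro power_mono) auto
      then show ?case
        by (simp add: norm_mult power_mult_distrib mult_right_mono)
    qed
    moreover have "(\<lambda>x. (cmod (\<phi> x * f x))\<^sup>2) \<in> borel_measurable nu"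
      by measurable
    ultimately have "integrable nu (\<lambda>x. (cmod (\<phi> x * f x))\<^sup>2)"
      using Bochner_Integration.integrable_bound by blast
    then show ?thesis by (simp add: square_integrable_def)
  qed
  show "L2_rel (\<lambda>x. if \<phi> \<in> L_infinity then \<phi> x * f x else 0)
      (\<lambda>x. if \<phi> \<in> L_infinity then \<phi> x * g x else 0)"
    using A B square_integrable_zero by (cases "\<phi> \<in> L_infinity") (auto simp: L2_rel_def)
qed

lemma measurable_arc_borel: "(\<lambda>z. z) \<in> arc_measure \<rightarrow>\<^sub>M borel"
  by (simp add: arc_measure_def measurable_restrict_space1)

lemma measurable_torus_fst [measurable]: "fst \<in> torus_measure \<rightarrow>\<^sub>M borel"
  and measurable_torus_snd [measurable]: "snd \<in> torus_measure \<rightarrow>\<^sub>M borel"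
  unfolding torus_measure_def
  using measurable_compose[OF measurable_fst measurable_arc_borel, of arc_measure]
    measurable_compose[OF measurable_snd measurable_arc_borel, of arc_measure]
  by simp_all

lemma space_torus_measure: "space torus_measure = unit_circle \<times> unit_circle"
  by (simp add: torus_measure_def space_pair_measure arc_measure_def space_restrict_space)

lemma measurable_jac [measurable]: "jac \<in> torus_measure \<rightarrow>\<^sub>M borel"
  unfolding jac_def by measurable

lemma measurable_sym_map [measurable]: "sym_map \<in> torus_measure \<rightarrow>\<^sub>M restrict_space borel bGamma"
proof (rule measurable_restrict_space2)
  show "sym_map \<in> space torus_measure \<rightarrow> bGamma"
    by (auto simp: space_torus_measure bGamma_def)
  have "sym_map \<in> torus_measure \<rightarrow>\<^sub>M borel \<Otimes>\<^sub>M borel"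
    unfolding sym_map_def by measurable
  then show "sym_map \<in> torus_measure \<rightarrow>\<^sub>M borel"
    by (simp add: borel_prod)
qed

lemma AE_nu_imp_AE_torus:
  assumes "AE x in nu. P x"
  shows "AE z in torus_measure. jac z \<noteq> 0 \<longrightarrow> P (sym_map z)"
proof -
  let ?D = "density torus_measure (\<lambda>z. ennreal ((cmod (jac z))\<^sup>2))"
  have "sym_map \<in> ?D \<rightarrow>\<^sub>M restrict_space borel bGamma"
    by simp
  from AE_distrD[OF this] assms have "AE z in ?D. P (sym_map z)"
    unfolding nu_def by blast
  then show ?thesis
    by (subst (asm) AE_density) (auto elim: eventually_mono)
qed

lemma coordinates_L_infinity: "fst \<in> L_infinity" "snd \<in> L_infinity"
proof -
  have [simp]: "space nu = bGamma"
    by (simp add: nu_def space_restrict_space)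
  have 1: "cmod (fst x) \<le> 2" "cmod (snd x) \<le> 1" if x: "x \<in> bGamma" for x
  proof -
    obtain a b where ab: "x = sym_map (a, b)" "cmod a = 1" "cmod b = 1"
      using x by (auto simp: bGamma_def)
    then show "cmod (fst x) \<le> 2"
      using norm_triangle_ineq[of a b] by (simp add: sym_map_def)
    show "cmod (snd x) \<le> 1"
      using ab by (simp add: sym_map_def norm_mult)
  qed
  have "fst \<in> borel_measurable nu" "snd \<in> borel_measurable nu"
    by (auto simp: nu_def intro!: measurable_restrict_space1 borel_measurable_continuous_onI
        continuous_intros)
  moreover have "AE x in nu. cmod (fst x) \<le> 2" "AE x in nu. cmod (snd x) \<le> 1"
    by (rule AE_I2; simp add: 1)+
  ultimately show "fst \<in> L_infinity" "snd \<in> L_infinity"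
    by (auto simp only: L_infinity_def)
qed

(* The unitary U onto the antisymmetric functions, on representatives. *)
definition L2_to_torus ::
  "(complex \<times> complex \<Rightarrow> complex) \<Rightarrow> complex \<times> complex \<Rightarrow> complex" where
  "L2_to_torus f z = (1 / complex_of_real jac_norm) * (jac z * f (sym_map z))"

lift_definition L2_fourier_coeff :: "bGamma_L2 \<Rightarrow> int \<Rightarrow> int \<Rightarrow> complex"
  is "\<lambda>f. fourier_coeff (L2_to_torus f)"
proof (intro ext)
  fix f g i j assume A: "L2_rel f g"
  then have "f \<in> borel_measurable nu" "g \<in> borel_measurable nu"
    by (auto simp: L2_rel_def square_integrable_def)
  then have [measurable]: "f \<in> borel_measurable (restrict_space borel bGamma)"
    "g \<in> borel_measurable (restrict_space borel bGamma)"
    by (simp_all add: nu_def)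
  have [measurable]: "(\<lambda>z. fst z powi k) \<in> borel_measurable torus_measure"
    "(\<lambda>z. snd z powi k) \<in> borel_measurable torus_measure" for k :: int
    unfolding power_int_def by measurable
  have "AE z in torus_measure. jac z \<noteq> 0 \<longrightarrow> f (sym_map z) = g (sym_map z)"
    using A by (intro AE_nu_imp_AE_torus) (simp add: L2_rel_def)
  then have "AE z in torus_measure.
      L2_to_torus f z * (fst z powi (- i) * snd z powi (- j)) =
      L2_to_torus g z * (fst z powi (- i) * snd z powi (- j))"
    by eventually_elim (auto simp: L2_to_torus_def)
  then show "fourier_coeff (L2_to_torus f) i j = fourier_coeff (L2_to_torus g) i j"
    unfolding fourier_coeff_def by (intro integral_cong_AE) (simp_all add: L2_to_torus_def)
qed

(* The Hardy space of the symmetrized bidisc, realized by boundary values. *)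
definition H2 :: "bGamma_L2 set" where
  "H2 = {f. \<forall>i j. \<not> (0 \<le> i \<and> 0 \<le> j) \<longrightarrow> L2_fourier_coeff f i j = 0}"

(* The bounded analytic functions on the symmetrized bidisc, realized by boundary values. *)
definition H_infinity :: "(complex \<times> complex \<Rightarrow> complex) set" where
  "H_infinity = {\<phi> \<in> L_infinity.
     \<forall>i j. \<not> (0 \<le> i \<and> 0 \<le> j) \<longrightarrow> fourier_coeff (\<phi> \<circ> sym_map) i j = 0}"

definition orth_proj :: "bGamma_L2 set \<Rightarrow> bGamma_L2 \<Rightarrow> bGamma_L2" where
  "orth_proj K f = (THE g. g \<in> K \<and> (\<forall>h\<in>K. L2_inner (f - g) h = 0))"

(* Operators on H2 are functions on the ambient type; only their values on H2 are relevant. *)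
definition toeplitz :: "(complex \<times> complex \<Rightarrow> complex) \<Rightarrow> bGamma_L2 \<Rightarrow> bGamma_L2" where
  "toeplitz \<phi> f = orth_proj H2 (mult_op \<phi> f)"

definition is_toeplitz :: "(bGamma_L2 \<Rightarrow> bGamma_L2) \<Rightarrow> bool" where
  "is_toeplitz A \<longleftrightarrow> (\<exists>\<psi>\<in>L_infinity. \<forall>f\<in>H2. A f = toeplitz \<psi> f)"

definition commute_on_H2 :: "(bGamma_L2 \<Rightarrow> bGamma_L2) \<Rightarrow> (bGamma_L2 \<Rightarrow> bGamma_L2) \<Rightarrow> bool" where
  "commute_on_H2 A B \<longleftrightarrow> (\<forall>f\<in>H2. A (B f) = B (A f))"

abbreviation T_s :: "bGamma_L2 \<Rightarrow> bGamma_L2" where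
  "T_s \<equiv> toeplitz fst"

abbreviation T_p :: "bGamma_L2 \<Rightarrow> bGamma_L2" where
  "T_p \<equiv> toeplitz snd"

end

theory Submission
  imports Defs "HOL-Probability.Probability"
begin

text \<open>
  Write $\hat f(k,l)$ for the Fourier coefficients of $Uf$, and $a$ for those of
  $\varphi\circ\pi$. The space $H^2$ is the closed span of the elements $e_{ij}$, $i > j \ge 0$,
  that $U$ maps to multiples of $z_1^i z_2^j - z_1^j z_2^i$, the projection onto $H^2$ truncates
  $\hat f$ to the quadrant $k, l \ge 0$, and the coefficient of $\varphi e_{ij}$ at $(k,l)$ is a
  multiple of $a(k-i,l-j) - a(k-j,l-i)$.

  If $\varphi$ is analytic, then $\varphi H^2 \subseteq H^2$, so $T_\varphi$ is multiplication by
  $\varphi$ and all five conditions are immediate. Conversely, comparing coefficients at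
  $(k,0)$, each condition forces the coefficients of $\varphi e_{ij}$ at $(k,-1)$ to vanish. Hence
  $a$ is eventually constant along every antidiagonal starting in the lower half plane, with the
  value at the starting point, and this constant is $0$ by Bessel's inequality. For the
  conditions (iv) and (vi) the same argument first identifies the symbol of the product.
\<close>

section \<open>Fourier coefficients on the torus\<close>

text \<open>The projection deletes the negative rows of \<open>\<phi> f\<close>. Multiplication by p
  moves coefficients by (1,1) and multiplication by s spreads them to two neighbours, so of the
  deleted rows only row -1 could have re-entered row 0. That is why every condition is tested there.
  One row suffices because the index j of the test element is free: the coefficient of
  \<open>\<phi>\<close> times \<open>basis i j\<close> at (k,-1) contains a(k-i,-1-j), and -1-j runs
  through all negative integers.

  The definitions dictate the preparation. \<open>orth_proj\<close> is a definite description on a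
  bare quotient, so nothing can be said about a Toeplitz operator before the projection is known to
  exist and to be unique; this asks for completeness of the quotient and closedness of
  \<open>H2\<close>. Equalities of elements are then read off from Fourier coefficients, so these
  must determine an element. That uniqueness is shown for integrable functions on the torus and
  transported through U.

  Orthogonality is complex, while the projection theorem is proved for the real part of the inner
  product; invariance of \<open>H2\<close> under multiplication by i closes the gap.\<close>

lemma space_arc [simp]: "space arc_measure = unit_circle"
  by (simp add: arc_measure_def space_restrict_space)

lemma measurable_cis_circle: "cis \<in> borel \<rightarrow>\<^sub>M restrict_space borel unit_circle"
  by (intro measurable_restrict_space2 borel_measurable_continuous_onI) (auto intro!: continuous_intros)

lemma prob_space_base: "prob_space (uniform_measure lborel {0..<2 * pi})"
  by (rule prob_space_uniform_measure) auto

lemma prob_space_arc: "prob_space arc_measure"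
  unfolding arc_measure_def
  using measurable_cis_circle
  by (intro prob_space.prob_space_distr[OF prob_space_base]) (simp cong: measurable_cong_sets)

interpretation arc: prob_space arc_measure by (rule prob_space_arc)
interpretation arc2: pair_prob_space arc_measure arc_measure ..

lemma prob_space_torus: "prob_space torus_measure"
  unfolding torus_measure_def by (rule arc2.prob_space_axioms)

interpretation torus: prob_space torus_measure by (rule prob_space_torus)
lemma sets_arc [measurable_cong]: "sets arc_measure = sets (restrict_space borel unit_circle)"
  by (simp add: arc_measure_def)

lemma cis_mult_has_antiderivative:
  fixes k :: int assumes "k \<noteq> 0" shows "((\<lambda>x. cis (of_int k * x) / (\<i> * of_int k)) has_vector_derivative cis (of_int k * x)) (at x within S)"
proof -
  have "((\<lambda>x. cis (of_int k * x)) has_derivative (\<lambda>t. (of_int k * t) *\<^sub>R (\<i> * cis (of_int k * x)))) (at x within S)"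
    by (auto intro!: derivative_eq_intros)
  then have "((\<lambda>x. cis (of_int k * x) / (\<i> * of_int k)) has_derivative (\<lambda>t. (of_int k * t) *\<^sub>R (\<i> * cis (of_int k * x)) / (\<i> * of_int k))) (at x within S)"
    by (rule bounded_linear.has_derivative[OF bounded_linear_divide])
  moreover have "(\<lambda>t. (of_int k * t) *\<^sub>R (\<i> * cis (of_int k * x)) / (\<i> * of_int k)) = (\<lambda>t. t *\<^sub>R cis (of_int k * x))"
    using assms by (auto simp: scaleR_conv_of_real fun_eq_iff complex_eq_iff)
  ultimately show ?thesis by (simp add: has_vector_derivative_def)
qed
lemma integral_arc_powi: "(\<integral>z. z powi k \<partial>arc_measure) = (if k = 0 then 1 else 0)"
proof -
  have cis_meas: "(\<lambda>x. cis (of_int k * x)) \<in> borel_measurable borel"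
    by (auto intro!: borel_measurable_continuous_onI continuous_intros)
  have "(\<integral>z. z powi k \<partial>arc_measure) = (\<integral>x. cis x powi k \<partial>uniform_measure lborel {0..<2 * pi})"
    unfolding arc_measure_def
  proof (rule integral_distr)
    show "cis \<in> uniform_measure lborel {0..<2 * pi} \<rightarrow>\<^sub>M restrict_space borel unit_circle"
      using measurable_cis_circle by (simp cong: measurable_cong_sets)
    show "(\<lambda>z. z powi k) \<in> borel_measurable (restrict_space borel unit_circle)"
      by (intro borel_measurable_continuous_on_restrict continuous_intros) auto
  qed
  also have "\<dots> = (\<integral>x. cis (of_int k * x) \<partial>uniform_measure lborel {0..<2 * pi})"
    by (simp add: cis_power_int)
  also have "\<dots> = (\<integral>x. indicator {0..<2*pi} x *\<^sub>R cis (of_int k * x) \<partial>lborel) / (2 * pi)"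
  proof -
    have "uniform_measure lborel {0..<2 * pi} = density lborel (\<lambda>x. ennreal (indicator {0..<2*pi} x / (2 * pi)))"
      unfolding uniform_measure_def
      by (intro density_cong) (auto simp: indicator_def divide_ennreal[symmetric] ennreal_mult)
    then have "(\<integral>x. cis (of_int k * x) \<partial>uniform_measure lborel {0..<2 * pi}) =
        (\<integral>x. (indicator {0..<2*pi} x / (2 * pi)) *\<^sub>R cis (of_int k * x) \<partial>lborel)"
      by (simp only:) (subst integral_density;
          auto intro!: borel_measurable_continuous_onI continuous_intros)
    also have "\<dots> = (\<integral>x. (1 / (2 * pi)) *\<^sub>R (indicator {0..<2*pi} x *\<^sub>R cis (of_int k * x)) \<partial>lborel)"
      by (intro Bochner_Integration.integral_cong) (auto simp: indicator_def)
    finally show ?thesis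
      by (simp only: integral_scaleR_right) (simp add: scaleR_conv_of_real)
  qed
  finally have 1: "(\<integral>z. z powi k \<partial>arc_measure) =
      (\<integral>x. indicator {0..<2*pi} x *\<^sub>R cis (of_int k * x) \<partial>lborel) / (2 * pi)" .
  have "(\<integral>x. indicator {0..<2*pi} x *\<^sub>R cis (of_int k * x) \<partial>lborel) =
    (\<integral>x. indicator {0..2*pi} x *\<^sub>R cis (of_int k * x) \<partial>lborel)"
  proof (rule integral_cong_AE)
    show "AE x in lborel. indicator {0..<2*pi} x *\<^sub>R cis (of_int k * x) = indicator {0..2*pi} x *\<^sub>R cis (of_int k * x)"
      using AE_lborel_singleton[of "2*pi"] by eventually_elim (auto simp: indicator_def)
  qed (auto intro!: borel_measurable_scaleR cis_meas)
  also have "\<dots> = (if k = 0 then 2 * pi else 0)"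
  proof (cases "k = 0")
    case False
    have "cis (of_int k * (2*pi)) = 1"
      using cis_multiple_2pi[of "of_int k"] by (simp add: mult_ac)
    then have "(\<integral>x. indicator {0..2*pi} x *\<^sub>R cis (of_int k * x) \<partial>lborel) = 0"
      by (subst integral_FTC_Icc[of 0 "2*pi" "\<lambda>x. cis (of_int k * x) / (\<i> * of_int k)"])
        (auto intro!: cis_mult_has_antiderivative False continuous_intros)
    with False show ?thesis by simp
  next
    case True
    then show ?thesis by (simp add: scaleR_conv_of_real)
  qed
  finally show ?thesis unfolding 1 by simp
qed

text \<open>The characters of the torus group. Conjugation negates both exponents only where the
  coordinates are unimodular, and exponents add only where they are nonzero; hence the premise on z
  in the rules below.\<close>

definition chr :: "int \<Rightarrow> int \<Rightarrow> complex \<times> complex \<Rightarrow> complex" where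
  "chr i j z = fst z powi i * snd z powi j"

lemma measurable_chr [measurable]: "chr i j \<in> borel_measurable torus_measure"
  unfolding chr_def power_int_def by measurable

lemma norm_chr: "z \<in> space torus_measure \<Longrightarrow> cmod (chr i j z) = 1"
  by (auto simp: space_torus_measure chr_def norm_mult norm_power_int)

lemma chr_mult: "z \<in> space torus_measure \<Longrightarrow> chr i j z * chr k l z = chr (i + k) (j + l) z"
proof -
  assume "z \<in> space torus_measure"
  then have "fst z \<noteq> 0" "snd z \<noteq> 0"
    by (auto simp: space_torus_measure)
  then show ?thesis
    by (simp add: chr_def power_int_add)
qed

lemma cnj_circle: "cmod z = 1 \<Longrightarrow> cnj z = inverse z"
  by (metis complex_norm_square inverse_unique of_real_1 one_power2)

lemma cnj_powi: "cnj (z powi k) = cnj z powi k"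
  by (simp add: power_int_def)

lemma cnj_chr: "z \<in> space torus_measure \<Longrightarrow> cnj (chr i j z) = chr (- i) (- j) z"
  by (auto simp: space_torus_measure chr_def cnj_circle power_int_minus power_int_inverse cnj_powi)

lemma fourier_coeff_chr: "fourier_coeff g i j = (\<integral>z. g z * chr (- i) (- j) z \<partial>torus_measure)"
  by (simp add: fourier_coeff_def chr_def)

lemma integral_chr: "(\<integral>z. chr i j z \<partial>torus_measure) = (if i = 0 \<and> j = 0 then 1 else 0)"
proof -
  have "integrable torus_measure (chr i j)"
    by (rule torus.integrable_const_bound[of _ 1]) (auto simp: norm_chr)
  then have "(\<integral>z. chr i j z \<partial>torus_measure) = (\<integral>x. (\<integral>y. chr i j (x, y) \<partial>arc_measure) \<partial>arc_measure)"
    unfolding torus_measure_def by (rule arc2.integral_fst'[symmetric])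
  also have "\<dots> = (if i = 0 \<and> j = 0 then 1 else 0)"
    by (simp add: chr_def integral_arc_powi)
  finally show ?thesis .
qed

text \<open>The arc measure has no atoms: in [0, 2 pi) only the parameter \<open>Arg2pi x\<close>
  can be sent to x by \<open>cis\<close>, and a single point is Lebesgue null.\<close>

lemma AE_arc_neq: "AE y in arc_measure. y \<noteq> x"
proof -
  have "AE t in lborel. t \<in> {0..<2 * pi} \<longrightarrow> cis t \<noteq> x"
    using AE_lborel_singleton[of "Arg2pi x"]
    by eventually_elim (auto simp: Arg2pi_unique[of 1] cis_conv_exp)
  then have "AE t in uniform_measure lborel {0..<2 * pi}. cis t \<noteq> x"
    by (subst AE_uniform_measure) auto
  then show ?thesis
    unfolding arc_measure_def
    using measurable_cis_circle by (subst AE_distr_iff) (auto cong: measurable_cong_sets simp: space_restrict_space sets_restrict_space intro!: rev_image_eqI[of "- {x}"])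
qed

text \<open>The diagonal is null by Fubini. Since \<open>nu\<close> carries the weight |J|^2, a
  statement holding \<open>nu\<close>-a.e. says nothing at zeros of J; this removes the exception
  when it is pulled back to the torus.\<close>

lemma AE_jac: "AE z in torus_measure. jac z \<noteq> 0"
  unfolding torus_measure_def
proof (rule arc2.AE_pair_measure)
  have "{z \<in> space torus_measure. jac z \<noteq> 0} \<in> sets torus_measure" by measurable
  then show "{z \<in> space (arc_measure \<Otimes>\<^sub>M arc_measure). jac z \<noteq> 0} \<in> sets (arc_measure \<Otimes>\<^sub>M arc_measure)"
    by (simp add: torus_measure_def)
  show "AE x in arc_measure. AE y in arc_measure. jac (x, y) \<noteq> 0"
  proof (rule AE_I2)
    fix x
    show "AE y in arc_measure. jac (x, y) \<noteq> 0"
      using AE_arc_neq[of x] by eventually_elim (auto simp: jac_def)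
  qed
qed

lemma distr_swap: "distr torus_measure torus_measure prod.swap = torus_measure"
  using arc2.distr_pair_swap by (simp add: torus_measure_def case_prod_beta' prod.swap_def[abs_def])

lemma measurable_swap [measurable]: "prod.swap \<in> torus_measure \<rightarrow>\<^sub>M torus_measure"
  unfolding torus_measure_def prod.swap_def by measurable

lemma integral_swap:
  assumes "f \<in> borel_measurable torus_measure"
  shows "(\<integral>z. f (prod.swap z) \<partial>torus_measure) = (\<integral>z. (f z :: complex) \<partial>torus_measure)"
  using integral_distr[OF measurable_swap assms] by (simp add: distr_swap)

section \<open>Uniqueness of Fourier coefficients for integrable functions on the torus\<close>

definition fourier_null :: "(complex \<times> complex \<Rightarrow> complex) \<Rightarrow> bool" where
  "fourier_null g \<longleftrightarrow> integrable torus_measure g \<and> (\<forall>i j. fourier_coeff g i j = 0)"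

lemma fourier_null_iff:
  "fourier_null g \<longleftrightarrow> integrable torus_measure g \<and> (\<forall>i j. (\<integral>z. g z * chr i j z \<partial>torus_measure) = 0)"
  unfolding fourier_null_def fourier_coeff_chr by (metis minus_minus)

lemma integrable_mult_bounded:
  fixes f g :: "complex \<times> complex \<Rightarrow> complex"
  assumes "integrable torus_measure f" "g \<in> borel_measurable torus_measure"
    and "AE z in torus_measure. cmod (g z) \<le> C"
  shows "integrable torus_measure (\<lambda>z. f z * g z)"
proof (rule Bochner_Integration.integrable_bound)
  show "integrable torus_measure (\<lambda>z. C *\<^sub>R f z)"
    using assms(1) by simp
  show "(\<lambda>z. f z * g z) \<in> borel_measurable torus_measure"
    using assms by measurable
  show "AE z in torus_measure. norm (f z * g z) \<le> norm (C *\<^sub>R f z)"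
    using assms(3)
  proof eventually_elim
    case (elim z)
    then show ?case
      by (simp add: norm_mult mult.commute[of "cmod (f z)"] mult_right_mono)
  qed
qed

lemma integrable_mult_chr:
  "integrable torus_measure f \<Longrightarrow> integrable torus_measure (\<lambda>z. f z * chr i j z)"
  by (rule integrable_mult_bounded[where C = 1]) (auto simp: norm_chr)

lemma fourier_null_add:
  "fourier_null f \<Longrightarrow> fourier_null g \<Longrightarrow> fourier_null (\<lambda>z. f z + g z)"
  by (simp add: fourier_null_iff distrib_right integrable_mult_chr)

lemma fourier_null_mult_const:
  assumes "fourier_null f" shows "fourier_null (\<lambda>z. f z * c)"
proof -
  have "(\<integral>z. f z * c * chr i j z \<partial>torus_measure) = c * (\<integral>z. f z * chr i j z \<partial>torus_measure)" for i j
    by (subst integral_mult_right_zero[symmetric]) (simp add: mult_ac)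
  with assms show ?thesis by (simp add: fourier_null_iff)
qed

lemma fourier_null_cong:
  assumes "fourier_null f" "\<And>z. z \<in> space torus_measure \<Longrightarrow> g z = f z"
  shows "fourier_null g"
proof -
  have "integrable torus_measure g \<longleftrightarrow> integrable torus_measure f"
    using assms(2) by (intro Bochner_Integration.integrable_cong) auto
  moreover have "(\<integral>z. g z * chr i j z \<partial>torus_measure) = (\<integral>z. f z * chr i j z \<partial>torus_measure)" for i j
    using assms(2) by (intro Bochner_Integration.integral_cong) auto
  ultimately show ?thesis using assms(1) by (simp add: fourier_null_iff)
qed

text \<open>A character factor only shifts the indices of the coefficients. This closure property
  lets trigonometric polynomials act as multipliers.\<close>

lemma fourier_null_mult_chr:
  assumes "fourier_null f" shows "fourier_null (\<lambda>z. f z * chr k l z)"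
proof -
  have "(\<integral>z. f z * chr k l z * chr i j z \<partial>torus_measure) = (\<integral>z. f z * chr (k + i) (l + j) z \<partial>torus_measure)" for i j
    by (intro Bochner_Integration.integral_cong refl) (simp add: mult.assoc chr_mult)
  with assms show ?thesis by (simp add: fourier_null_iff integrable_mult_chr)
qed

lemma chr_coordinates:
  assumes "z \<in> space torus_measure"
  shows "chr 1 0 z = fst z" "chr 0 1 z = snd z" "chr (-1) 0 z = cnj (fst z)" "chr 0 (-1) z = cnj (snd z)"
  using assms by (auto simp: chr_def space_torus_measure cnj_circle power_int_minus)

text \<open>On the torus a real linear functional is a combination of z1, z2 and their conjugates,
  thus of four characters. Together with constants these functionals generate the real polynomial
  functions.\<close>

lemma fourier_null_mult_linear:
  fixes q :: "complex \<times> complex \<Rightarrow> real"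
  assumes f: "fourier_null f" and q: "bounded_linear q"
  shows "fourier_null (\<lambda>z. f z * of_real (q z))"
proof -
  interpret bounded_linear q by fact
  define a b c d where "a = q (1, 0)" "b = q (\<i>, 0)" "c = q (0, 1)" "d = q (0, \<i>)"
  have q_eq: "q z = Re (fst z) * a + Im (fst z) * b + Re (snd z) * c + Im (snd z) * d" for z
  proof -
    have "z = Re (fst z) *\<^sub>R (1, 0) + Im (fst z) *\<^sub>R (\<i>, 0) + Re (snd z) *\<^sub>R (0, 1) + Im (snd z) *\<^sub>R (0, \<i>)"
      by (simp add: prod_eq_iff complex_eq_iff)
    then have "q z = q (Re (fst z) *\<^sub>R (1, 0) + Im (fst z) *\<^sub>R (\<i>, 0) + Re (snd z) *\<^sub>R (0, 1) + Im (snd z) *\<^sub>R (0, \<i>))"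
      by simp
    then show ?thesis unfolding add scaleR a_b_c_d_def by simp
  qed
  have re: "complex_of_real (Re w) = (w + cnj w) / 2" and im: "complex_of_real (Im w) = (w - cnj w) / (2 * \<i>)" for w
    by (auto simp: complex_eq_iff)
  \<comment> \<open>Coefficients of w and \<open>cnj w\<close> when s Re w + t Im w is rewritten in
    these two.\<close>
  define A B where "A = (\<lambda>s t. (complex_of_real s + of_real t / \<i>) / 2)" "B = (\<lambda>s t. (complex_of_real s - of_real t / \<i>) / 2)"
  have *: "complex_of_real (Re w) * of_real s + of_real (Im w) * of_real t = w * A s t + cnj w * B s t" for w s t
    unfolding re im A_B_def by (simp add: field_simps)
  show ?thesis
  proof (rule fourier_null_cong)
    show "fourier_null (\<lambda>z. f z * chr 1 0 z * A a b + f z * chr (-1) 0 z * B a b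
      + (f z * chr 0 1 z * A c d + f z * chr 0 (-1) z * B c d))"
      by (intro fourier_null_add fourier_null_mult_const fourier_null_mult_chr f)
    fix z assume z: "z \<in> space torus_measure"
    have "of_real (q z) = (fst z * A a b + cnj (fst z) * B a b) + (snd z * A c d + cnj (snd z) * B c d)"
      unfolding q_eq by (simp add: *[symmetric])
    then show "f z * of_real (q z) = f z * chr 1 0 z * A a b + f z * chr (-1) 0 z * B a b
      + (f z * chr 0 1 z * A c d + f z * chr 0 (-1) z * B c d)"
      using z by (simp add: chr_coordinates algebra_simps)
  qed
qed

text \<open>Since the multiplicand ranges over all Fourier-null functions, the admissible multipliers are
  closed under products.\<close>

lemma fourier_null_mult_polynomial:
  assumes "real_polynomial_function q" "fourier_null f"
  shows "fourier_null (\<lambda>z. f z * of_real (q z))"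
  using assms
proof (induction arbitrary: f)
  case (add p q)
  then show ?case by (simp add: distrib_left fourier_null_add)
next
  case (mult p q)
  from mult.IH(2)[OF mult.IH(1)[OF mult.prems]] show ?case by (simp add: mult.assoc)
qed (auto intro: fourier_null_mult_linear fourier_null_mult_const)

lemma fourier_null_integral_zero: "fourier_null f \<Longrightarrow> (\<integral>z. f z \<partial>torus_measure) = 0"
  unfolding fourier_null_iff by (drule conjunct2, drule spec[of _ 0], drule spec[of _ 0]) (simp add: chr_def)

lemma measurable_torus_id [measurable]: "(\<lambda>z. z) \<in> torus_measure \<rightarrow>\<^sub>M borel"
  using measurable_Pair[OF measurable_torus_fst measurable_torus_snd] by (simp add: borel_prod)

lemma measurable_torus_continuous:
  "continuous_on UNIV h \<Longrightarrow> h \<in> borel_measurable torus_measure"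
  using measurable_compose[OF measurable_torus_id borel_measurable_continuous_onI] by simp

text \<open>Stone-Weierstrass on the compact torus: the integral changes by at most the uniform
  error times the L^1 norm of f, and polynomials contribute 0.\<close>

lemma fourier_null_integral_continuous:
  fixes h :: "complex \<times> complex \<Rightarrow> real"
  assumes f: "fourier_null f" and h: "continuous_on UNIV h"
  shows "(\<integral>z. f z * of_real (h z) \<partial>torus_measure) = 0"
proof -
  let ?T = "unit_circle \<times> unit_circle"
  have T: "compact ?T" by (intro compact_Times) auto
  have hT: "continuous_on ?T h" using h continuous_on_subset by blast
  have fi: "integrable torus_measure f" using f by (simp add: fourier_null_def)
  have hm: "(\<lambda>z. complex_of_real (h z)) \<in> borel_measurable torus_measure"
    using measurable_torus_continuous[OF h] by measurable
  obtain C where C: "\<And>z. z \<in> ?T \<Longrightarrow> \<bar>h z\<bar> \<le> C"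
    using compact_imp_bounded[OF compact_continuous_image[OF hT T]]
    by (auto simp: bounded_iff)
  have fhi: "integrable torus_measure (\<lambda>z. f z * of_real (h z))"
    by (rule integrable_mult_bounded[where C = C]) (use fi hm C in \<open>auto simp: space_torus_measure\<close>)
  have "cmod (\<integral>z. f z * of_real (h z) \<partial>torus_measure) \<le> 0 + e" if "e > 0" for e
  proof -
    define N where "N = (\<integral>z. cmod (f z) \<partial>torus_measure)"
    have "N \<ge> 0" by (simp add: N_def)
    \<comment> \<open>The summand 1 keeps the denominator positive when the L^1 norm of f is
      0.\<close>
    with that have e: "e / (N + 1) > 0" by (simp add: add_nonneg_pos)
    obtain g where g: "real_polynomial_function g" "\<And>z. z \<in> ?T \<Longrightarrow> \<bar>h z - g z\<bar> < e / (N + 1)"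
      using Stone_Weierstrass_real_polynomial_function[OF T hT e] by blast
    have gn: "fourier_null (\<lambda>z. f z * of_real (g z))"
      by (rule fourier_null_mult_polynomial) fact+
    have "(\<integral>z. f z * of_real (h z) \<partial>torus_measure) = (\<integral>z. f z * of_real (h z) - f z * of_real (g z) \<partial>torus_measure)"
      using fhi gn fourier_null_integral_zero[OF gn] by (simp add: fourier_null_def)
    also have "cmod \<dots> \<le> (\<integral>z. cmod (f z * of_real (h z) - f z * of_real (g z)) \<partial>torus_measure)"
      by (rule integral_norm_bound)
    also have "\<dots> \<le> (\<integral>z. cmod (f z) * (e / (N + 1)) \<partial>torus_measure)"
    proof (rule integral_mono)
      show "integrable torus_measure (\<lambda>z. cmod (f z * of_real (h z) - f z * of_real (g z)))"
        using fhi gn by (simp add: fourier_null_def)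
      show "integrable torus_measure (\<lambda>z. cmod (f z) * (e / (N + 1)))"
        using fi by simp
      fix z assume "z \<in> space torus_measure"
      then have "\<bar>h z - g z\<bar> \<le> e / (N + 1)" using g(2)[of z] by (simp add: space_torus_measure)
      moreover have "cmod (f z * of_real (h z) - f z * of_real (g z)) = cmod (f z) * \<bar>h z - g z\<bar>"
        by (simp add: norm_mult right_diff_distrib[symmetric] of_real_diff[symmetric] del: of_real_diff)
      ultimately show "cmod (f z * of_real (h z) - f z * of_real (g z)) \<le> cmod (f z) * (e / (N + 1))"
        by (simp add: mult_left_mono del: times_divide_eq_right)
    qed
    also have "\<dots> = N * (e / (N + 1))" by (simp only: N_def integral_mult_left_zero)
    also have "\<dots> \<le> 0 + e" using \<open>N \<ge> 0\<close> that by (simp add: field_simps)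
    finally show ?thesis .
  qed
  then have "cmod (\<integral>z. f z * of_real (h z) \<partial>torus_measure) \<le> 0"
    by (rule field_le_epsilon)
  then show ?thesis by simp
qed

text \<open>The indicator of a closed set is the pointwise limit of continuous functions with values
  in [0,1], so dominated convergence applies with |f| as the bound.\<close>

lemma fourier_null_integral_closed:
  assumes f: "fourier_null f" and C: "closed C"
  shows "(\<integral>z. indicator C z *\<^sub>R f z \<partial>torus_measure) = 0"
\<comment> \<open>\<open>infdist\<close> to the empty set is 0 by convention, so the functions
  \<open>h n\<close> would be constantly 1 there.\<close>
proof (cases "C = {}")
  case False
  define h where "h n z = max 0 (1 - real n * infdist z C)" for n and z :: "complex \<times> complex"
  have cont: "continuous_on UNIV (h n)" for n
    unfolding h_def by (intro continuous_intros)
  have fi[measurable]: "integrable torus_measure f" using f by (simp add: fourier_null_def)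
  have lim: "(\<lambda>n. h n z) \<longlonglongrightarrow> indicator C z" for z
  proof (cases "z \<in> C")
    case True
    then show ?thesis by (simp add: h_def)
  next
    case False
    then have p: "infdist z C > 0"
      using C \<open>C \<noteq> {}\<close> by (simp add: infdist_pos_not_in_closed)
    obtain N where N: "real N * infdist z C > 1" using p reals_Archimedean3 by blast
    have "h n z = 0" if "n \<ge> N" for n
    proof -
      have "real N * infdist z C \<le> real n * infdist z C" using that p by (intro mult_right_mono) auto
      with N show ?thesis by (simp add: h_def)
    qed
    then have "eventually (\<lambda>n. h n z = 0) sequentially"
      using eventually_sequentially by auto
    with False show ?thesis by (simp add: tendsto_eventually)
  qed
  have "(\<lambda>n. \<integral>z. h n z *\<^sub>R f z \<partial>torus_measure) \<longlonglongrightarrow> (\<integral>z. indicator C z *\<^sub>R f z \<partial>torus_measure)"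
  proof (rule integral_dominated_convergence[where w = "\<lambda>z. cmod (f z)"])
    show "(\<lambda>z. indicator C z *\<^sub>R f z) \<in> borel_measurable torus_measure"
      using borel_closed[OF C] by measurable
    show "(\<lambda>z. h n z *\<^sub>R f z) \<in> borel_measurable torus_measure" for n
      using measurable_torus_continuous[OF cont[of n]] by measurable
    show "AE z in torus_measure. (\<lambda>n. h n z *\<^sub>R f z) \<longlonglongrightarrow> indicator C z *\<^sub>R f z"
      by (intro AE_I2 tendsto_intros lim)
    show "AE z in torus_measure. norm (h n z *\<^sub>R f z) \<le> cmod (f z)" for n
      by (intro AE_I2) (auto simp: h_def infdist_nonneg intro!: mult_left_le_one_le)
  qed (use fi in auto)
  moreover have "(\<integral>z. h n z *\<^sub>R f z \<partial>torus_measure) = 0" for n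
    using fourier_null_integral_continuous[OF f cont[of n]] by (simp add: scaleR_conv_of_real mult.commute)
  ultimately show ?thesis by (simp add: LIMSEQ_const_iff)
qed simp

text \<open>Dynkin's argument: the closed sets are a generator stable under intersection, and the
  sets with vanishing integral form a Dynkin system.\<close>

lemma fourier_null_integral_borel:
  assumes f: "fourier_null f" and "A \<in> sets borel"
  shows "(\<integral>z. indicator A z *\<^sub>R f z \<partial>torus_measure) = 0"
proof -
  have fi[measurable]: "integrable torus_measure f" using f by (simp add: fourier_null_def)
  have ind: "integrable torus_measure (\<lambda>z. indicator A z *\<^sub>R f z)" if [measurable]: "A \<in> sets borel" for A
    using fi by (rule Bochner_Integration.integrable_bound) (measurable, auto simp: indicator_def)
  have "Int_stable (Collect closed :: (complex \<times> complex) set set)"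
    by (auto simp: Int_stable_def)
  moreover have "Collect closed \<subseteq> Pow (UNIV :: (complex \<times> complex) set)" by simp
  moreover have "A \<in> sigma_sets UNIV (Collect closed)"
    using assms(2) by (simp add: borel_eq_closed sets_measure_of)
  ultimately show ?thesis
  proof (induction rule: sigma_sets_induct_disjoint)
    case (basic A)
    then show ?case using fourier_null_integral_closed[OF f] by simp
  next
    case empty
    show ?case by simp
  next
    case (compl A)
    then have [measurable]: "A \<in> sets borel" by (simp add: borel_eq_closed sets_measure_of)
    have "(\<integral>z. indicator (UNIV - A) z *\<^sub>R f z \<partial>torus_measure) = (\<integral>z. f z - indicator A z *\<^sub>R f z \<partial>torus_measure)"
      by (intro Bochner_Integration.integral_cong) (auto simp: indicator_def)
    then show ?case
      using compl ind[of A] fi fourier_null_integral_zero[OF f] by simp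
  next
    case (union A)
    then have [measurable]: "A i \<in> sets borel" for i
      by (auto simp: borel_eq_closed sets_measure_of)
    have "(\<integral>z. indicator (\<Union>(range A)) z *\<^sub>R f z \<partial>torus_measure) = (\<Sum>i. \<integral>z. indicator (A i) z *\<^sub>R f z \<partial>torus_measure)"
    proof -
      let ?A = "\<lambda>i. A i \<inter> space torus_measure"
      have [measurable]: "?A i \<in> sets torus_measure" for i
        using measurable_sets[OF measurable_torus_id, of "A i"] by simp
      have eq: "indicator (\<Union>(range A)) z *\<^sub>R f z = indicator (\<Union>(range ?A)) z *\<^sub>R f z"
        "indicator (A i) z *\<^sub>R f z = indicator (?A i) z *\<^sub>R f z"
        if "z \<in> space torus_measure" for z i
        using that by (auto simp: indicator_def)
      have "set_integrable torus_measure (\<Union>(range ?A)) f"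
        unfolding set_integrable_def using fi by (intro integrable_mult_indicator) auto
      from lebesgue_integral_countable_add[OF _ _ this]
      have "(\<integral>z. indicator (\<Union>(range ?A)) z *\<^sub>R f z \<partial>torus_measure) = (\<Sum>i. \<integral>z. indicator (?A i) z *\<^sub>R f z \<partial>torus_measure)"
        using union.hyps(1) by (auto simp: set_lebesgue_integral_def disjoint_family_on_def)
      then show ?thesis
        by (simp add: eq cong: Bochner_Integration.integral_cong)
    qed
    then show ?case using union by simp
  qed
qed

theorem fourier_null_AE_zero:
  assumes f: "fourier_null f"
  shows "AE z in torus_measure. f z = 0"
proof (rule torus.density_zero)
  show "integrable torus_measure f" using f by (simp add: fourier_null_def)
  fix A assume A: "A \<in> sets torus_measure"
  let ?T = "unit_circle \<times> unit_circle"
  \<comment> \<open>Sets of \<open>torus_measure\<close> come from a product of restricted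
    sigma-algebras; measurability of this identity map shows that each of them is Borel in the plane
    of pairs.\<close>
  have "(\<lambda>z. z) \<in> restrict_space borel ?T \<rightarrow>\<^sub>M torus_measure"
    unfolding torus_measure_def
  proof (rule measurable_pair)
    have "(fst :: complex \<times> complex \<Rightarrow> _) \<in> borel_measurable borel" "(snd :: complex \<times> complex \<Rightarrow> _) \<in> borel_measurable borel"
      by (auto intro!: borel_measurable_continuous_onI continuous_intros)
    then show "fst \<circ> (\<lambda>z. z) \<in> restrict_space borel ?T \<rightarrow>\<^sub>M arc_measure"
      "snd \<circ> (\<lambda>z. z) \<in> restrict_space borel ?T \<rightarrow>\<^sub>M arc_measure"
      unfolding measurable_cong_sets[OF refl sets_arc]
      by (intro measurable_restrict_space2; auto intro!: measurable_restrict_space1 simp: comp_def space_restrict_space)+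
  qed
  then have "(\<lambda>z. z) -` A \<inter> space (restrict_space borel ?T) \<in> sets (restrict_space borel ?T)"
    using A by (rule measurable_sets)
  then have "A \<inter> ?T \<in> sets borel"
    by (subst (asm) sets_restrict_space_iff) (auto simp: space_restrict_space borel_closed closed_Times)
  moreover have "A \<inter> ?T = A"
    using sets.sets_into_space[OF A] by (auto simp: space_torus_measure)
  ultimately show "set_lebesgue_integral torus_measure A f = 0"
    using fourier_null_integral_borel[OF f] by (simp add: set_lebesgue_integral_def)
qed

section \<open>The Hilbert space over the distinguished boundary\<close>

text \<open>On the torus |J|^2 = 2 - z1/z2 - z2/z1, and the two nontrivial characters integrate to
  0.\<close>

lemma jac_norm_squared: "jac_norm\<^sup>2 = 2"
proof -
  have eq: "complex_of_real ((cmod (jac z))\<^sup>2) = 2 - chr 1 (-1) z - chr (-1) 1 z"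
    if z: "z \<in> space torus_measure" for z
  proof -
    have "complex_of_real ((cmod (jac z))\<^sup>2) = (fst z - snd z) * (cnj (fst z) - cnj (snd z))"
      by (simp only: complex_norm_square jac_def complex_cnj_diff)
    also have "\<dots> = (chr 1 0 z - chr 0 1 z) * (chr (-1) 0 z - chr 0 (-1) z)"
      using z by (simp only: chr_coordinates)
    also have "\<dots> = 2 - chr 1 (-1) z - chr (-1) 1 z"
      using z by (simp add: algebra_simps chr_mult) (simp add: chr_def)
    finally show ?thesis .
  qed
  have int: "integrable torus_measure (chr i j)" for i j
    by (rule torus.integrable_const_bound[of _ 1]) (auto simp: norm_chr)
  have "complex_of_real (\<integral>z. (cmod (jac z))\<^sup>2 \<partial>torus_measure) = (\<integral>z. complex_of_real ((cmod (jac z))\<^sup>2) \<partial>torus_measure)"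
    by (rule integral_complex_of_real[symmetric])
  also have "\<dots> = (\<integral>z. 2 - chr 1 (-1) z - chr (-1) 1 z \<partial>torus_measure)"
    using eq by (intro Bochner_Integration.integral_cong) auto
  also have "\<dots> = 2"
    using int by (simp add: integral_chr torus.prob_space)
  finally have "(\<integral>z. (cmod (jac z))\<^sup>2 \<partial>torus_measure) = 2"
    using of_real_eq_iff by fastforce
  then show ?thesis by (simp add: jac_norm_def)
qed

lemma jac_norm_pos: "jac_norm > 0"
proof -
  have "jac_norm \<ge> 0" by (simp add: jac_norm_def)
  moreover have "jac_norm \<noteq> 0" using jac_norm_squared by auto
  ultimately show ?thesis by simp
qed

lemma space_nu [simp]: "space nu = bGamma"
  by (simp add: nu_def space_restrict_space)

lemma sets_nu [measurable_cong]: "sets nu = sets (restrict_space borel bGamma)"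
  by (simp add: nu_def)

lemma measurable_nu_compose_sym_map:
  "f \<in> borel_measurable nu \<Longrightarrow> (\<lambda>z. f (sym_map z)) \<in> borel_measurable torus_measure"
  using measurable_compose[OF measurable_sym_map] by (simp cong: measurable_cong_sets)

lemma
  fixes f :: "complex \<times> complex \<Rightarrow> 'a :: {banach, second_countable_topology}"
  assumes f: "f \<in> borel_measurable nu"
  shows integral_nu: "(\<integral>x. f x \<partial>nu) = (\<integral>z. (cmod (jac z))\<^sup>2 *\<^sub>R f (sym_map z) \<partial>torus_measure)"
    and integrable_nu_iff: "integrable nu f \<longleftrightarrow> integrable torus_measure (\<lambda>z. (cmod (jac z))\<^sup>2 *\<^sub>R f (sym_map z))"
proof -
  note m = measurable_nu_compose_sym_map[OF f]
  have f': "f \<in> borel_measurable (restrict_space borel bGamma)"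
    using f by (simp cong: measurable_cong_sets)
  show "(\<integral>x. f x \<partial>nu) = (\<integral>z. (cmod (jac z))\<^sup>2 *\<^sub>R f (sym_map z) \<partial>torus_measure)"
    unfolding nu_def using m f'
    by (subst integral_distr) (auto simp: integral_density)
  show "integrable nu f \<longleftrightarrow> integrable torus_measure (\<lambda>z. (cmod (jac z))\<^sup>2 *\<^sub>R f (sym_map z))"
    unfolding nu_def using m f'
    by (subst integrable_distr_eq) (auto simp: integrable_density)
qed

lemma norm_jac_le: "z \<in> space torus_measure \<Longrightarrow> cmod (jac z) \<le> 2"
  using norm_triangle_ineq4[of "fst z" "snd z"] by (auto simp: jac_def space_torus_measure)

lemma finite_measure_nu: "finite_measure nu"
proof -
  let ?D = "density torus_measure (\<lambda>z. ennreal ((cmod (jac z))\<^sup>2))"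
  have "emeasure ?D (space ?D) = (\<integral>\<^sup>+z. ennreal ((cmod (jac z))\<^sup>2) \<partial>torus_measure)"
    by (subst emeasure_density) (auto intro!: nn_integral_cong)
  also have "\<dots> \<le> (\<integral>\<^sup>+z. ennreal 4 \<partial>torus_measure)"
  proof (intro nn_integral_mono ennreal_leI)
    fix z assume "z \<in> space torus_measure"
    then have "(cmod (jac z))\<^sup>2 \<le> 2\<^sup>2" by (intro power_mono norm_jac_le) auto
    then show "(cmod (jac z))\<^sup>2 \<le> 4" by simp
  qed
  also have "\<dots> < \<infinity>" by (simp add: torus.emeasure_space_1)
  finally have "finite_measure ?D" by (intro finite_measureI) simp
  then show ?thesis
    unfolding nu_def by (rule finite_measure.finite_measure_distr) simp
qed

interpretation nu: finite_measure nu by (rule finite_measure_nu)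

lemma square_integrable_measurable: "square_integrable f \<Longrightarrow> f \<in> borel_measurable nu"
  by (simp add: square_integrable_def)

lemma measurable_cnj [measurable (raw)]:
  "f \<in> borel_measurable M \<Longrightarrow> (\<lambda>x. cnj (f x)) \<in> borel_measurable M"
  by (auto intro!: borel_measurable_continuous_on[of cnj] continuous_intros)

lemma integrable_mult_cnj:
  assumes "square_integrable f" "square_integrable g"
  shows "integrable nu (\<lambda>x. f x * cnj (g x))"
proof (rule Bochner_Integration.integrable_bound)
  show "integrable nu (\<lambda>x. (cmod (f x))\<^sup>2 + (cmod (g x))\<^sup>2)"
    using assms by (simp add: square_integrable_def)
  have [measurable]: "f \<in> borel_measurable nu" "g \<in> borel_measurable nu"
    using assms by (auto simp: square_integrable_def)
  show "(\<lambda>x. f x * cnj (g x)) \<in> borel_measurable nu" by measurable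
  have "cmod (f x) * cmod (g x) \<le> (cmod (f x))\<^sup>2 + (cmod (g x))\<^sup>2" for x
    using sum_squares_bound[of "cmod (f x)" "cmod (g x)"] mult_nonneg_nonneg[of "cmod (f x)" "cmod (g x)"]
    by (simp del: mult_nonneg_nonneg)
  then show "AE x in nu. norm (f x * cnj (g x)) \<le> norm ((cmod (f x))\<^sup>2 + (cmod (g x))\<^sup>2)"
    by (simp add: norm_mult)
qed

lemma square_integrable_mult_const:
  assumes "square_integrable f" shows "square_integrable (\<lambda>x. c * f x)"
  using assms by (auto simp: square_integrable_def norm_mult power_mult_distrib)

text \<open>Complex scalars stay a separate operation, since the type becomes a real inner product
  space; \<open>cscale \<i>\<close> is what recovers complex orthogonality.\<close>

lift_definition cscale :: "complex \<Rightarrow> bGamma_L2 \<Rightarrow> bGamma_L2" is "\<lambda>c f x. c * f x"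
  by (auto simp: L2_rel_def square_integrable_mult_const)

lemma L2_inner_add_left: "L2_inner (f + g) h = L2_inner f h + L2_inner g h"
  by transfer (simp add: L2_rel_def distrib_right integrable_mult_cnj add_divide_distrib)

lemma L2_inner_cscale_left: "L2_inner (cscale c f) h = c * L2_inner f h"
  by transfer (simp add: L2_rel_def mult.assoc)

lemma L2_inner_commute: "L2_inner g f = cnj (L2_inner f g)"
proof transfer
  fix g f :: "complex \<times> complex \<Rightarrow> complex"
  have "cnj (\<integral>x. f x * cnj (g x) \<partial>nu) = (\<integral>x. g x * cnj (f x) \<partial>nu)"
    by (subst Bochner_Integration.integral_cnj[symmetric]) (simp add: mult.commute)
  then show "(\<integral>x. g x * cnj (f x) \<partial>nu) / complex_of_real (jac_norm\<^sup>2) =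
      cnj ((\<integral>x. f x * cnj (g x) \<partial>nu) / complex_of_real (jac_norm\<^sup>2))"
    by simp
qed

lemma L2_inner_self:
  "L2_rel f f \<Longrightarrow> (\<integral>x. f x * cnj (f x) \<partial>nu) = of_real (\<integral>x. (cmod (f x))\<^sup>2 \<partial>nu)"
  by (simp add: complex_norm_square[symmetric] flip: integral_complex_of_real)

lemma L2_inner_self_nonneg: "Re (L2_inner f f) \<ge> 0"
  by transfer (simp add: L2_inner_self)

lemma L2_inner_self_eq_zero: "Re (L2_inner f f) = 0 \<longleftrightarrow> f = 0"
proof transfer
  fix f assume f: "L2_rel f f"
  then have [measurable]: "f \<in> borel_measurable nu" and "integrable nu (\<lambda>x. (cmod (f x))\<^sup>2)"
    by (auto simp: L2_rel_def square_integrable_def)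
  then have "(\<integral>x. (cmod (f x))\<^sup>2 \<partial>nu) = 0 \<longleftrightarrow> (AE x in nu. f x = 0)"
    by (subst integral_nonneg_eq_0_iff_AE) auto
  then show "Re ((\<integral>x. f x * cnj (f x) \<partial>nu) / complex_of_real (jac_norm\<^sup>2)) = 0 \<longleftrightarrow> L2_rel f (\<lambda>_. 0)"
    using f jac_norm_pos by (auto simp: L2_inner_self L2_rel_def square_integrable_zero)
qed

instantiation bGamma_L2 :: real_vector
begin

definition scaleR_bGamma_L2 :: "real \<Rightarrow> bGamma_L2 \<Rightarrow> bGamma_L2" where
  "scaleR_bGamma_L2 r f = cscale (of_real r) f"

instance
proof
  fix f g :: bGamma_L2 and r s :: real
  show "r *\<^sub>R (f + g) = r *\<^sub>R f + r *\<^sub>R g" "(r + s) *\<^sub>R f = r *\<^sub>R f + s *\<^sub>R f"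
    "r *\<^sub>R s *\<^sub>R f = (r * s) *\<^sub>R f" "1 *\<^sub>R f = f"
    unfolding scaleR_bGamma_L2_def
    by (transfer; auto simp: L2_rel_def distrib_left distrib_right mult.assoc
        intro!: square_integrable_add square_integrable_mult_const)+
qed

end

instantiation bGamma_L2 :: real_inner
begin

definition inner_bGamma_L2 :: "bGamma_L2 \<Rightarrow> bGamma_L2 \<Rightarrow> real" where
  "inner_bGamma_L2 f g = Re (L2_inner f g)"

definition norm_bGamma_L2 :: "bGamma_L2 \<Rightarrow> real" where
  "norm_bGamma_L2 f = sqrt (inner f f)"

definition dist_bGamma_L2 :: "bGamma_L2 \<Rightarrow> bGamma_L2 \<Rightarrow> real" where
  "dist_bGamma_L2 f g = norm (f - g)"

definition sgn_bGamma_L2 :: "bGamma_L2 \<Rightarrow> bGamma_L2" where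
  "sgn_bGamma_L2 f = f /\<^sub>R norm f"

definition uniformity_bGamma_L2 :: "(bGamma_L2 \<times> bGamma_L2) filter" where
  "uniformity_bGamma_L2 = (INF e\<in>{0<..}. principal {(x, y). dist x y < e})"

definition open_bGamma_L2 :: "bGamma_L2 set \<Rightarrow> bool" where
  "open_bGamma_L2 U \<longleftrightarrow> (\<forall>x\<in>U. \<forall>\<^sub>F (x', y) in uniformity. x' = x \<longrightarrow> y \<in> U)"

instance
proof
  fix f g h :: bGamma_L2 and r s :: real
  show "f \<bullet> g = g \<bullet> f"
    using L2_inner_commute[of f g] by (simp add: inner_bGamma_L2_def)
  show "(f + g) \<bullet> h = f \<bullet> h + g \<bullet> h"
    by (simp add: inner_bGamma_L2_def L2_inner_add_left)
  show "r *\<^sub>R f \<bullet> g = r * (f \<bullet> g)"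
    by (simp add: inner_bGamma_L2_def scaleR_bGamma_L2_def L2_inner_cscale_left)
  show "0 \<le> f \<bullet> f" "f \<bullet> f = 0 \<longleftrightarrow> f = 0"
    by (simp_all add: inner_bGamma_L2_def L2_inner_self_nonneg L2_inner_self_eq_zero)
qed (simp_all add: norm_bGamma_L2_def dist_bGamma_L2_def sgn_bGamma_L2_def uniformity_bGamma_L2_def
    open_bGamma_L2_def)

end


lemma norm_abs_squared:
  assumes "L2_rel f f"
  shows "(norm (abs_bGamma_L2 f))\<^sup>2 = (\<integral>x. (cmod (f x))\<^sup>2 \<partial>nu) / 2"
proof -
  have "(norm (abs_bGamma_L2 f))\<^sup>2 = Re (L2_inner (abs_bGamma_L2 f) (abs_bGamma_L2 f))"
    by (simp only: power2_norm_eq_inner inner_bGamma_L2_def)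
  also have "\<dots> = Re (of_real ((\<integral>x. (cmod (f x))\<^sup>2 \<partial>nu) / 2))"
    by (simp only: L2_inner.abs_eq[OF assms assms] L2_inner_self[OF assms] jac_norm_squared of_real_divide)
  finally show ?thesis by simp
qed

section \<open>Completeness and the projection theorem\<close>

lemma L2_rel_self: "L2_rel f f \<longleftrightarrow> square_integrable f"
  by (auto simp: L2_rel_def)

lemma square_integrable_rep: "square_integrable (rep_bGamma_L2 x)"
  using Quotient_rep_reflp[OF Quotient_bGamma_L2] unfolding L2_rel_self .

lemma abs_rep: "abs_bGamma_L2 (rep_bGamma_L2 x) = x"
  by (rule Quotient_abs_rep[OF Quotient_bGamma_L2])

lemma norm_diff_squared:
  assumes "square_integrable f" "square_integrable g"
  shows "(norm (abs_bGamma_L2 f - abs_bGamma_L2 g))\<^sup>2 = (\<integral>x. (cmod (f x - g x))\<^sup>2 \<partial>nu) / 2"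
  using assms square_integrable_diff[OF assms]
  by (subst minus_bGamma_L2.abs_eq) (simp_all only: L2_rel_self norm_abs_squared)

text \<open>As \<open>nu\<close> is finite, geometric decay of the L^2 norms yields geometric decay
  of L^1 norms. The sum of the moduli is then integrable by monotone convergence, hence finite
  a.e.\<close>

lemma AE_summable_geometric_L2:
  fixes d :: "nat \<Rightarrow> complex \<times> complex \<Rightarrow> complex"
  assumes d: "\<And>n. square_integrable (d n)"
    and bound: "\<And>n. (\<integral>x. (cmod (d n x))\<^sup>2 \<partial>nu) \<le> B * (1/4) ^ n"
  shows "AE x in nu. summable (\<lambda>n. cmod (d n x))"
proof -
  have [measurable]: "d n \<in> borel_measurable nu" for n using d by (simp add: square_integrable_def)
  define M where "M = measure nu (space nu)"
  have int: "integrable nu (\<lambda>x. (1/2) ^ n + 2 ^ n * (cmod (d n x))\<^sup>2)" for n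
    using d by (simp add: square_integrable_def)
  \<comment> \<open>$t \le 1 + t^2$ at $t = 2^n |d_n|$ gives $L^1$-summability without the Cauchy--Schwarz inequality\<close>
  have le: "cmod (d n x) \<le> (1/2) ^ n + 2 ^ n * (cmod (d n x))\<^sup>2" for n x
  proof -
    have "0 \<le> ((2 ^ n * cmod (d n x) - 1)\<^sup>2 + (2 ^ n * cmod (d n x)))"
      by simp
    then have "2 ^ n * cmod (d n x) \<le> 1 + (2 ^ n * cmod (d n x))\<^sup>2"
      by (simp add: power2_diff mult.commute)
    also have "\<dots> = 2 ^ n * ((1/2) ^ n + 2 ^ n * (cmod (d n x))\<^sup>2)"
      by (simp add: distrib_left power_one_over power_mult_distrib power2_eq_square)
    finally show ?thesis
      by (rule mult_left_le_imp_le) simp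
  qed
  have "(\<integral>\<^sup>+x. ennreal (cmod (d n x)) \<partial>nu) \<le> ennreal ((M + B) * (1/2) ^ n)" for n
  proof -
    have "(\<integral>\<^sup>+x. ennreal (cmod (d n x)) \<partial>nu) \<le> (\<integral>\<^sup>+x. ennreal ((1/2) ^ n + 2 ^ n * (cmod (d n x))\<^sup>2) \<partial>nu)"
      using le by (intro nn_integral_mono ennreal_leI)
    also have "\<dots> = ennreal (\<integral>x. (1/2) ^ n + 2 ^ n * (cmod (d n x))\<^sup>2 \<partial>nu)"
      by (rule nn_integral_eq_integral[OF int]) auto
    also have "(\<integral>x. (1/2) ^ n + 2 ^ n * (cmod (d n x))\<^sup>2 \<partial>nu) = M * (1/2) ^ n + 2 ^ n * (\<integral>x. (cmod (d n x))\<^sup>2 \<partial>nu)"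
      using d by (simp add: square_integrable_def M_def)
    also have "\<dots> \<le> M * (1/2) ^ n + 2 ^ n * (B * (1/4) ^ n)"
      using bound by simp
    also have "\<dots> = (M + B) * (1/2) ^ n"
      by (simp add: distrib_right power_mult_distrib[symmetric] mult.left_commute[of _ B])
    finally show ?thesis using ennreal_leI by blast
  qed
  then have "(\<Sum>n. \<integral>\<^sup>+x. ennreal (cmod (d n x)) \<partial>nu) \<le> (\<Sum>n. ennreal ((M + B) * (1/2) ^ n))"
    by (intro suminf_le) auto
  also have "\<dots> < \<infinity>"
  proof -
    have "B \<ge> 0" using order_trans[OF _ bound[of 0], of 0] by simp
    then have "(\<Sum>n. ennreal ((M + B) * (1/2) ^ n)) = ennreal (\<Sum>n. (M + B) * (1/2) ^ n)"
      by (intro suminf_ennreal2 summable_mult summable_geometric) (auto simp: M_def)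
    then show ?thesis by simp
  qed
  finally have "(\<integral>\<^sup>+x. (\<Sum>n. ennreal (cmod (d n x))) \<partial>nu) \<noteq> \<infinity>"
    by (simp add: nn_integral_suminf)
  then have "AE x in nu. (\<Sum>n. ennreal (cmod (d n x))) \<noteq> \<infinity>"
    by (intro nn_integral_PInf_AE) auto
  then show ?thesis
    by eventually_elim (auto intro: summable_suminf_not_top)
qed

lemma half_power_squared: "((1/2::real) ^ n)\<^sup>2 = (1/4) ^ n"
proof -
  have "((1/2::real) ^ n)\<^sup>2 = ((1/2)\<^sup>2) ^ n"
    by (simp only: power_mult[symmetric] mult.commute[of n 2])
  then show ?thesis by (simp add: power2_eq_square)
qed

text \<open>The Riesz-Fischer argument: a rapidly converging subsequence has an a.e. limit, Fatou's
  lemma makes it a limit in norm, and a Cauchy sequence follows its subsequence.\<close>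

instance bGamma_L2 :: complete_space
proof
  fix X :: "nat \<Rightarrow> bGamma_L2"
  assume X: "Cauchy X"
  have "\<exists>r::nat \<Rightarrow> nat. strict_mono r \<and> (\<forall>n. \<forall>m\<ge>r n. norm (X m - X (r n)) < (1/2) ^ n)"
  proof -
    have "\<exists>M. \<forall>i\<ge>M. \<forall>j\<ge>M. norm (X i - X j) < (1/2) ^ n" for n
      using CauchyD[OF X, of "(1/2) ^ n"] by simp
    then obtain M where M: "\<And>n i j. i \<ge> M n \<Longrightarrow> j \<ge> M n \<Longrightarrow> norm (X i - X j) < (1/2) ^ n"
      by metis
    \<comment> \<open>The sum dominates \<open>M n\<close> and is increasing; the added n makes the
      increase strict.\<close>
    define r :: "nat \<Rightarrow> nat" where "r n = (\<Sum>k\<le>n. M k) + n" for n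
    have "strict_mono r"
      by (rule strict_monoI_Suc) (simp add: r_def)
    moreover have "M n \<le> r n" for n
      by (simp add: r_def member_le_sum[of n "{..n}" M] trans_le_add1)
    ultimately show ?thesis
      using M by (intro exI[of _ r]) (meson order_trans)
  qed
  then obtain r where r: "strict_mono (r :: nat \<Rightarrow> nat)" "\<And>n m. m \<ge> r n \<Longrightarrow> norm (X m - X (r n)) < (1/2) ^ n"
    by blast
  define F where "F n = rep_bGamma_L2 (X (r n))" for n
  have F: "square_integrable (F n)" "X (r n) = abs_bGamma_L2 (F n)" for n
    by (simp_all add: F_def square_integrable_rep abs_rep)
  have [measurable]: "F n \<in> borel_measurable nu" for n using F(1) by (simp add: square_integrable_def)
  \<comment> \<open>The factor 2 undoes the normalization of the norm by
    \<open>jac_norm\<close>.\<close>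
  have FF: "(\<integral>x. (cmod (F m x - F n x))\<^sup>2 \<partial>nu) \<le> 2 * (1/4) ^ n" if "m \<ge> n" for m n
  proof -
    have "norm (X (r m) - X (r n)) < (1/2) ^ n"
      using r that by (simp add: strict_mono_less_eq)
    then have "(norm (X (r m) - X (r n)))\<^sup>2 \<le> ((1/2) ^ n)\<^sup>2"
      by (intro power_mono) auto
    also have "\<dots> = (1/4) ^ n"
      by (rule half_power_squared)
    finally show ?thesis
      by (simp add: F norm_diff_squared)
  qed
  have "AE x in nu. summable (\<lambda>n. cmod (F (Suc n) x - F n x))"
    by (rule AE_summable_geometric_L2[where B = 2]) (auto intro: square_integrable_diff F FF)
  then have conv: "AE x in nu. convergent (\<lambda>n. F n x)"
  proof eventually_elim
    case (elim x)
    then have "summable (\<lambda>n. F (Suc n) x - F n x)" by (rule summable_norm_cancel)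
    then have "convergent (\<lambda>n. \<Sum>k<n. F (Suc k) x - F k x)"
      by (simp add: summable_iff_convergent)
    then have "convergent (\<lambda>n. F n x - F 0 x)"
      by (simp only: sum_lessThan_telescope[of "\<lambda>n. F n x"])
    from convergent_add[OF this convergent_const, of "F 0 x"] show ?case by simp
  qed
  define G where "G x = lim (\<lambda>n. F n x)" for x
  have [measurable]: "G \<in> borel_measurable nu"
    unfolding G_def by (rule borel_measurable_lim_metric) simp
  have lim: "AE x in nu. (\<lambda>n. F n x) \<longlonglongrightarrow> G x"
    using conv by eventually_elim (simp add: G_def convergent_LIMSEQ_iff)
  \<comment> \<open>Fatou's lemma in m, with n fixed.\<close>
  have GF: "(\<integral>\<^sup>+x. ennreal ((cmod (G x - F n x))\<^sup>2) \<partial>nu) \<le> ennreal (2 * (1/4) ^ n)" for n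
  proof -
    have "(\<integral>\<^sup>+x. ennreal ((cmod (G x - F n x))\<^sup>2) \<partial>nu) =
        (\<integral>\<^sup>+x. liminf (\<lambda>m. ennreal ((cmod (F m x - F n x))\<^sup>2)) \<partial>nu)"
    proof (rule nn_integral_cong_AE)
      show "AE x in nu. ennreal ((cmod (G x - F n x))\<^sup>2) = liminf (\<lambda>m. ennreal ((cmod (F m x - F n x))\<^sup>2))"
        using lim
      proof eventually_elim
        case (elim x)
        then have "(\<lambda>m. ennreal ((cmod (F m x - F n x))\<^sup>2)) \<longlonglongrightarrow> ennreal ((cmod (G x - F n x))\<^sup>2)"
          by (intro tendsto_intros)
        from lim_imp_Liminf[OF sequentially_bot this] show ?case by (rule sym)
      qed
    qed
    also have "\<dots> \<le> liminf (\<lambda>m. \<integral>\<^sup>+x. ennreal ((cmod (F m x - F n x))\<^sup>2) \<partial>nu)"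
      by (rule nn_integral_liminf) simp
    also have "\<dots> \<le> ennreal (2 * (1/4) ^ n)"
    proof (rule Liminf_le[OF sequentially_bot])
      show "\<forall>\<^sub>F m in sequentially. (\<integral>\<^sup>+x. ennreal ((cmod (F m x - F n x))\<^sup>2) \<partial>nu) \<le> ennreal (2 * (1/4) ^ n)"
        using eventually_ge_at_top[of n]
      proof eventually_elim
        case (elim m)
        have "integrable nu (\<lambda>x. (cmod (F m x - F n x))\<^sup>2)"
          using square_integrable_diff[OF F(1) F(1)] by (simp add: square_integrable_def)
        then show ?case
          using FF[OF elim] by (subst nn_integral_eq_integral) (auto intro!: ennreal_leI)
      qed
    qed
    finally show ?thesis .
  qed
  have sqGF: "square_integrable (\<lambda>x. G x - F n x)" for n
    unfolding square_integrable_def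
  proof
    show "integrable nu (\<lambda>x. (cmod (G x - F n x))\<^sup>2)"
      using le_less_trans[OF GF[of n]] by (intro integrableI_bounded) auto
  qed simp
  from square_integrable_add[OF sqGF[of 0] F(1)[of 0]] have sqG: "square_integrable G" by simp
  have "dist (X (r n)) (abs_bGamma_L2 G) \<le> (1/2) ^ n" for n
  proof (rule power2_le_imp_le)
    have "integrable nu (\<lambda>x. (cmod (G x - F n x))\<^sup>2)"
      using sqGF by (simp add: square_integrable_def)
    with GF[of n] have "(\<integral>x. (cmod (G x - F n x))\<^sup>2 \<partial>nu) \<le> 2 * (1/4) ^ n"
      by (subst (asm) nn_integral_eq_integral) auto
    moreover have "(dist (X (r n)) (abs_bGamma_L2 G))\<^sup>2 = (\<integral>x. (cmod (G x - F n x))\<^sup>2 \<partial>nu) / 2"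
      by (simp add: dist_commute dist_norm F norm_diff_squared sqG)
    moreover note half_power_squared[of n]
    ultimately show "(dist (X (r n)) (abs_bGamma_L2 G))\<^sup>2 \<le> ((1/2) ^ n)\<^sup>2"
      by linarith
  qed simp
  then have "\<forall>\<^sub>F n in sequentially. norm (dist (X (r n)) (abs_bGamma_L2 G)) \<le> (1/2) ^ n"
    by simp
  moreover have "(\<lambda>n. (1/2::real) ^ n) \<longlonglongrightarrow> 0"
    by (rule LIMSEQ_power_zero) simp
  ultimately have "(\<lambda>n. dist (X (r n)) (abs_bGamma_L2 G)) \<longlonglongrightarrow> 0"
    by (rule Lim_null_comparison)
  then have "(X \<circ> r) \<longlonglongrightarrow> abs_bGamma_L2 G"
    unfolding o_def by (subst tendsto_dist_iff)
  then have "X \<longlonglongrightarrow> abs_bGamma_L2 G"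
    by (rule Cauchy_converges_subseq[OF X r(1)])
  then show "convergent X" by (auto simp: convergent_def)
qed

text \<open>A minimizing sequence for the distance is Cauchy because midpoints stay in K; a
  minimizer is orthogonal to K because moving along a direction of K cannot decrease the
  distance.\<close>

lemma closed_subspace_projection_exists:
  fixes f :: "'a :: {real_inner, complete_space}"
  assumes K: "subspace K" "closed K"
  shows "\<exists>g\<in>K. \<forall>h\<in>K. (f - g) \<bullet> h = 0"
proof -
  define d where "d = (INF k\<in>K. (norm (f - k))\<^sup>2)"
  have ne: "K \<noteq> {}" using K(1) subspace_0 by blast
  have bdd: "bdd_below ((\<lambda>k. (norm (f - k))\<^sup>2) ` K)" by (rule bdd_belowI[of _ 0]) auto
  have d_le: "d \<le> (norm (f - k))\<^sup>2" if "k \<in> K" for k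
    unfolding d_def using bdd that by (rule cINF_lower)
  have "\<exists>k\<in>K. (norm (f - k))\<^sup>2 < d + inverse (real (Suc n))" for n
    using cINF_less_iff[OF ne bdd, of "d + inverse (real (Suc n))"] by (simp add: d_def)
  then obtain k where k: "\<And>n. k n \<in> K" "\<And>n. (norm (f - k n))\<^sup>2 < d + inverse (real (Suc n))"
    by metis
  have k_dist: "(norm (k m - k n))\<^sup>2 \<le> 4 * inverse (real (Suc N))" if "m \<ge> N" "n \<ge> N" for m n N
  proof -
    have mid: "(1/2) *\<^sub>R (k m + k n) \<in> K"
      using K(1) k(1) by (intro subspace_scale subspace_add)
    \<comment> \<open>The parallelogram law for \<open>f - k m\<close> and
      \<open>f - k n\<close>.\<close>
    have "(norm (k m - k n))\<^sup>2 = 2 * (norm (f - k m))\<^sup>2 + 2 * (norm (f - k n))\<^sup>2 - 4 * (norm (f - (1/2) *\<^sub>R (k m + k n)))\<^sup>2"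
      unfolding power2_norm_eq_inner
      by (simp add: inner_diff_left inner_diff_right inner_add_left inner_add_right inner_commute algebra_simps)
    also have "\<dots> \<le> 2 * (d + inverse (real (Suc m))) + 2 * (d + inverse (real (Suc n))) - 4 * d"
    proof -
      have "2 * a + 2 * b - 4 * c \<le> 2 * p + 2 * q - 4 * d" if "a < p" "b < q" "d \<le> c" for a b c p q :: real
        using that by linarith
      from this[OF k(2)[of m] k(2)[of n] d_le[OF mid]] show ?thesis .
    qed
    also have "\<dots> \<le> 4 * inverse (real (Suc N))"
    proof -
      have "inverse (real (Suc m)) \<le> inverse (real (Suc N))" "inverse (real (Suc n)) \<le> inverse (real (Suc N))"
        using that by (auto intro!: le_imp_inverse_le)
      then show ?thesis by (simp only: distrib_left)
    qed
    finally show ?thesis .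
  qed
  have "Cauchy k"
  proof (rule metric_CauchyI)
    fix e :: real assume e: "e > 0"
    then obtain N where N: "inverse (real (Suc N)) < e\<^sup>2 / 4"
      using reals_Archimedean[of "e\<^sup>2 / 4"] by auto
    have "dist (k m) (k n) < e" if "m \<ge> N" "n \<ge> N" for m n
    proof (rule power2_less_imp_less)
      show "(dist (k m) (k n))\<^sup>2 < e\<^sup>2"
        using k_dist[OF that] N by (simp add: dist_norm)
    qed (use e in auto)
    then show "\<exists>M. \<forall>m\<ge>M. \<forall>n\<ge>M. dist (k m) (k n) < e" by blast
  qed
  then obtain g where g: "k \<longlonglongrightarrow> g" using Cauchy_convergent convergent_def by blast
  have "g \<in> K" using K(2) k(1) g closed_sequentially by blast
  have "(\<lambda>n. (norm (f - k n))\<^sup>2) \<longlonglongrightarrow> (norm (f - g))\<^sup>2"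
    by (intro tendsto_intros g)
  moreover have "(\<lambda>n. d + inverse (real (Suc n))) \<longlonglongrightarrow> d + 0"
    by (intro tendsto_intros LIMSEQ_inverse_real_of_nat)
  ultimately have g_le: "(norm (f - g))\<^sup>2 \<le> d"
    using k(2) by (intro LIMSEQ_le) (auto intro: less_imp_le)
  have "(f - g) \<bullet> h = 0" if h: "h \<in> K" for h
  proof (cases "h = 0")
    case False
    \<comment> \<open>The minimizer of the quadratic function t -> |f - g - t h|^2.\<close>
    define t where "t = ((f - g) \<bullet> h) / (h \<bullet> h)"
    have "g + t *\<^sub>R h \<in> K" using K(1) \<open>g \<in> K\<close> h by (intro subspace_add subspace_scale)
    from order_trans[OF g_le d_le[OF this]]
    have "(norm (f - g))\<^sup>2 \<le> (norm (f - (g + t *\<^sub>R h)))\<^sup>2" .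
    also have "\<dots> = (norm (f - g))\<^sup>2 - 2 * t * ((f - g) \<bullet> h) + t\<^sup>2 * (h \<bullet> h)"
      unfolding power2_norm_eq_inner power2_eq_square[of t]
      by (simp add: inner_diff_left inner_diff_right inner_add_left inner_add_right inner_commute algebra_simps)
    also have "\<dots> = (norm (f - g))\<^sup>2 - ((f - g) \<bullet> h)\<^sup>2 / (h \<bullet> h)"
      using False by (simp add: t_def power2_eq_square field_simps)
    finally have "((f - g) \<bullet> h)\<^sup>2 / (h \<bullet> h) \<le> 0" by simp
    moreover have "h \<bullet> h > 0" using False by simp
    ultimately show ?thesis
      by (simp add: divide_le_0_iff)
  qed simp
  with \<open>g \<in> K\<close> show ?thesis by blast
qed

section \<open>The Hardy space\<close>

lemma L_infinity_bounded:
  assumes "\<phi> \<in> L_infinity"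
  obtains C where "AE z in torus_measure. cmod (\<phi> (sym_map z)) \<le> C"
proof -
  obtain C where "AE x in nu. cmod (\<phi> x) \<le> C" using assms by (auto simp: L_infinity_def)
  from AE_nu_imp_AE_torus[OF this] AE_jac have "AE z in torus_measure. cmod (\<phi> (sym_map z)) \<le> C"
    by eventually_elim simp
  then show thesis by (rule that)
qed

lemma L_infinity_measurable: "\<phi> \<in> L_infinity \<Longrightarrow> \<phi> \<in> borel_measurable nu"
  by (simp add: L_infinity_def)

lemma L_infinity_integrable:
  assumes "\<phi> \<in> L_infinity" shows "integrable torus_measure (\<lambda>z. \<phi> (sym_map z))"
proof -
  obtain C where "AE z in torus_measure. cmod (\<phi> (sym_map z)) \<le> C"
    using assms by (rule L_infinity_bounded)
  then show ?thesis
    by (rule torus.integrable_const_bound)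
      (intro measurable_nu_compose_sym_map L_infinity_measurable assms)
qed

lemma L_infinity_mult:
  assumes "\<phi> \<in> L_infinity" "\<psi> \<in> L_infinity" shows "(\<lambda>x. \<phi> x * \<psi> x) \<in> L_infinity"
proof -
  obtain C D where "AE x in nu. cmod (\<phi> x) \<le> C" "AE x in nu. cmod (\<psi> x) \<le> D"
    using assms by (auto simp: L_infinity_def)
  then have "AE x in nu. cmod (\<phi> x * \<psi> x) \<le> C * D"
  proof eventually_elim
    case (elim x)
    then show ?case
      unfolding norm_mult by (intro mult_mono) (auto intro: order_trans[OF norm_ge_zero])
  qed
  with assms show ?thesis by (auto simp: L_infinity_def)
qed

lemma L_infinity_diff:
  assumes "\<phi> \<in> L_infinity" "\<psi> \<in> L_infinity" shows "(\<lambda>x. \<phi> x - \<psi> x) \<in> L_infinity"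
proof -
  obtain C D where "AE x in nu. cmod (\<phi> x) \<le> C" "AE x in nu. cmod (\<psi> x) \<le> D"
    using assms by (auto simp: L_infinity_def)
  then have "AE x in nu. cmod (\<phi> x - \<psi> x) \<le> C + D"
  proof eventually_elim
    case (elim x)
    then show ?case using norm_triangle_ineq4[of "\<phi> x" "\<psi> x"] by linarith
  qed
  with assms show ?thesis by (auto simp: L_infinity_def)
qed

lemma L_infinity_cnj: "\<phi> \<in> L_infinity \<Longrightarrow> (\<lambda>x. cnj (\<phi> x)) \<in> L_infinity"
  by (auto simp: L_infinity_def)

text \<open>The estimate is contained in the well-definedness of \<open>mult_op\<close> and is read
  off from its respectfulness theorem.\<close>

lemma square_integrable_mult:
  assumes "\<phi> \<in> L_infinity" "square_integrable f"
  shows "square_integrable (\<lambda>x. \<phi> x * f x)"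
  using rel_funD[OF rel_funD[OF mult_op.rsp, OF refl[of \<phi>]], of f f] assms
  by (simp add: L2_rel_self)

lemma mult_op_abs:
  assumes "\<phi> \<in> L_infinity" "square_integrable f"
  shows "mult_op \<phi> (abs_bGamma_L2 f) = abs_bGamma_L2 (\<lambda>x. \<phi> x * f x)"
  using assms by (simp add: mult_op.abs_eq L2_rel_self)

lemma bGamma_L2_abs_cases [case_names abs]:
  obtains f where "square_integrable f" "x = abs_bGamma_L2 f"
  using square_integrable_rep[of x] abs_rep[of x, symmetric] by (rule that)

lemma mult_op_commute:
  assumes "\<phi> \<in> L_infinity" "\<psi> \<in> L_infinity"
  shows "mult_op \<phi> (mult_op \<psi> f) = mult_op \<psi> (mult_op \<phi> f)"
  by (cases f rule: bGamma_L2_abs_cases)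
    (simp add: assms mult_op_abs square_integrable_mult mult.left_commute)

lemma mult_op_mult:
  assumes "\<phi> \<in> L_infinity" "\<psi> \<in> L_infinity"
  shows "mult_op (\<lambda>x. \<phi> x * \<psi> x) f = mult_op \<phi> (mult_op \<psi> f)"
  by (cases f rule: bGamma_L2_abs_cases)
    (simp add: assms mult_op_abs square_integrable_mult L_infinity_mult mult.assoc)

lemma mult_op_diff:
  assumes "\<phi> \<in> L_infinity" "\<psi> \<in> L_infinity"
  shows "mult_op (\<lambda>x. \<phi> x - \<psi> x) f = mult_op \<phi> f - mult_op \<psi> f"
  by (cases f rule: bGamma_L2_abs_cases)
    (simp add: assms mult_op_abs square_integrable_mult L_infinity_diff left_diff_distrib
      minus_bGamma_L2.abs_eq L2_rel_self)

lemma mult_op_adjoint: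
  assumes "\<phi> \<in> L_infinity"
  shows "L2_inner (mult_op \<phi> f) g = L2_inner f (mult_op (\<lambda>x. cnj (\<phi> x)) g)"
  by (cases f rule: bGamma_L2_abs_cases; cases g rule: bGamma_L2_abs_cases)
    (simp add: assms mult_op_abs square_integrable_mult L_infinity_cnj L2_inner.abs_eq L2_rel_self
      mult.assoc mult.left_commute)

section \<open>Fourier coefficients of U f and the antisymmetric basis\<close>

lemma measurable_L2_to_torus:
  "square_integrable f \<Longrightarrow> L2_to_torus f \<in> borel_measurable torus_measure"
  unfolding L2_to_torus_def[abs_def]
  using measurable_nu_compose_sym_map[of f] by (auto simp: square_integrable_def)

lemma integrable_L2_to_torus:
  assumes f: "square_integrable f" shows "integrable torus_measure (L2_to_torus f)"
proof (rule Bochner_Integration.integrable_bound)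
  have fm: "f \<in> borel_measurable nu" and "integrable nu (\<lambda>x. (cmod (f x))\<^sup>2)"
    using f by (auto simp: square_integrable_def)
  then have "integrable torus_measure (\<lambda>z. (cmod (jac z))\<^sup>2 *\<^sub>R (cmod (f (sym_map z)))\<^sup>2)"
    by (subst integrable_nu_iff[symmetric]) auto
  then show "integrable torus_measure (\<lambda>z. 1 + (1 / jac_norm\<^sup>2) * ((cmod (jac z))\<^sup>2 *\<^sub>R (cmod (f (sym_map z)))\<^sup>2))"
    by simp
  show "L2_to_torus f \<in> borel_measurable torus_measure" by (rule measurable_L2_to_torus[OF f])
  have eq: "(1 / jac_norm\<^sup>2) * ((cmod (jac z))\<^sup>2 *\<^sub>R (cmod (f (sym_map z)))\<^sup>2) = (cmod (L2_to_torus f z))\<^sup>2" for z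
    by (simp add: L2_to_torus_def norm_mult norm_divide power_mult_distrib power_divide)
  have "t \<le> 1 + t\<^sup>2" if "t \<ge> 0" for t :: real
    using that zero_le_power2[of "t - 1"] by (simp add: power2_diff)
  then show "AE z in torus_measure. norm (L2_to_torus f z) \<le>
      norm (1 + (1 / jac_norm\<^sup>2) * ((cmod (jac z))\<^sup>2 *\<^sub>R (cmod (f (sym_map z)))\<^sup>2))"
    unfolding eq by simp
qed

lemma L2_fourier_coeff_abs:
  "square_integrable f \<Longrightarrow> L2_fourier_coeff (abs_bGamma_L2 f) i j = (\<integral>z. L2_to_torus f z * chr (- i) (- j) z \<partial>torus_measure)"
  by (simp add: L2_fourier_coeff.abs_eq L2_rel_self fourier_coeff_chr)

lemma L2_fourier_coeff_diff:
  "L2_fourier_coeff (f - g) i j = L2_fourier_coeff f i j - L2_fourier_coeff g i j"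
proof (cases f rule: bGamma_L2_abs_cases; cases g rule: bGamma_L2_abs_cases)
  fix u v assume uv: "square_integrable u" "f = abs_bGamma_L2 u" "square_integrable v" "g = abs_bGamma_L2 v"
  have "L2_to_torus (\<lambda>x. u x - v x) z = L2_to_torus u z - L2_to_torus v z" for z
    by (simp add: L2_to_torus_def algebra_simps)
  with uv show ?thesis
    by (simp add: minus_bGamma_L2.abs_eq L2_rel_self L2_fourier_coeff_abs square_integrable_diff
        left_diff_distrib integrable_mult_chr integrable_L2_to_torus)
qed

text \<open>Exchanging the coordinates changes the sign of J and fixes \<open>sym_map\<close>, so U
  f is antisymmetric. Coefficients with l < k therefore carry all information.\<close>

lemma L2_fourier_coeff_swap: "L2_fourier_coeff f j i = - L2_fourier_coeff f i j"
proof (cases f rule: bGamma_L2_abs_cases)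
  case (abs u)
  have sw: "L2_to_torus u (prod.swap z) * chr (- j) (- i) (prod.swap z) = - (L2_to_torus u z * chr (- i) (- j) z)" for z
    by (simp add: L2_to_torus_def chr_def jac_def sym_map_def algebra_simps)
  have "(\<lambda>z. L2_to_torus u z * chr (- j) (- i) z) \<in> borel_measurable torus_measure"
    using measurable_L2_to_torus[OF abs(1)] by measurable
  from integral_swap[OF this] show ?thesis
    unfolding abs(2) L2_fourier_coeff_abs[OF abs(1)] sw by simp
qed

lemma L2_fourier_coeff_diag: "L2_fourier_coeff f i i = 0"
  using L2_fourier_coeff_swap[of f i i] by (simp add: eq_neg_iff_add_eq_0)

text \<open>U is injective: the uniqueness theorem kills U f, and up to a constant the squared norm
  of f is the integral of |J|^2 |f o pi|^2.\<close>

lemma L2_eq_zero: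
  assumes "\<And>i j. L2_fourier_coeff f i j = 0" shows "f = 0"
proof (cases f rule: bGamma_L2_abs_cases)
  case (abs u)
  have "fourier_null (L2_to_torus u)"
    using assms unfolding abs(2) fourier_null_def L2_fourier_coeff.abs_eq[OF abs(1)[folded L2_rel_self]]
    by (simp add: integrable_L2_to_torus abs)
  then have ae: "AE z in torus_measure. L2_to_torus u z = 0"
    by (rule fourier_null_AE_zero)
  have m: "(\<lambda>x. (cmod (u x))\<^sup>2) \<in> borel_measurable nu"
    using square_integrable_measurable[OF abs(1)] by measurable
  have "(\<integral>x. (cmod (u x))\<^sup>2 \<partial>nu) = (\<integral>z. (cmod (jac z))\<^sup>2 *\<^sub>R (cmod (u (sym_map z)))\<^sup>2 \<partial>torus_measure)"
    by (rule integral_nu[OF m])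
  also have "\<dots> = (\<integral>z. 0 \<partial>torus_measure)"
  proof (rule integral_cong_AE)
    show "(\<lambda>z. (cmod (jac z))\<^sup>2 *\<^sub>R (cmod (u (sym_map z)))\<^sup>2) \<in> borel_measurable torus_measure"
      using measurable_nu_compose_sym_map[OF m] by measurable
    show "AE z in torus_measure. (cmod (jac z))\<^sup>2 *\<^sub>R (cmod (u (sym_map z)))\<^sup>2 = 0"
      using ae by eventually_elim (use jac_norm_pos in \<open>auto simp: L2_to_torus_def\<close>)
  qed simp
  finally have "(norm f)\<^sup>2 = 0"
    unfolding abs(2) by (subst norm_abs_squared) (simp_all add: abs L2_rel_self)
  then show ?thesis by simp
qed

text \<open>In terms of $s = z_1 + z_2$ and $p = z_1 z_2$, \<open>hsum n\<close> is the complete homogeneous symmetric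
  polynomial of degree $n$ in $z_1, z_2$, and \<open>schur k l\<close> is
  $(z_1^k z_2^l - z_1^l z_2^k) / (z_1 - z_2)$. The latter is meaningful for \<open>l < k\<close> only, but \<open>l\<close> may
  be negative.\<close>

fun hsum :: "nat \<Rightarrow> complex \<times> complex \<Rightarrow> complex" where
  "hsum 0 x = 1"
| "hsum (Suc 0) x = fst x"
| "hsum (Suc (Suc n)) x = fst x * hsum (Suc n) x - snd x * hsum n x"

definition schur :: "int \<Rightarrow> int \<Rightarrow> complex \<times> complex \<Rightarrow> complex" where
  "schur k l x = snd x powi l * hsum (nat (k - l - 1)) x"

text \<open>Both sides satisfy the recurrence with characteristic polynomial x^2 - s x + p, whose
  roots are z1 and z2.\<close>

lemma jac_hsum: "jac z * hsum n (sym_map z) = fst z ^ Suc n - snd z ^ Suc n"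
proof (induction n "sym_map z" rule: hsum.induct)
  case (3 n)
  have "jac z * hsum (Suc (Suc n)) (sym_map z) =
      fst (sym_map z) * (jac z * hsum (Suc n) (sym_map z)) - snd (sym_map z) * (jac z * hsum n (sym_map z))"
    by (simp add: algebra_simps)
  also have "\<dots> = fst z ^ Suc (Suc (Suc n)) - snd z ^ Suc (Suc (Suc n))"
    unfolding 3 by (simp add: sym_map_def algebra_simps)
  finally show ?case .
qed (simp_all add: jac_def sym_map_def algebra_simps power2_eq_square)

lemma jac_schur:
  assumes z: "z \<in> space torus_measure" and kl: "l < k"
  shows "jac z * schur k l (sym_map z) = chr k l z - chr l k z"
proof -
  have nz: "fst z \<noteq> 0" "snd z \<noteq> 0" using z by (auto simp: space_torus_measure)
  \<comment> \<open>Here \<open>l < k\<close> makes the truncation by \<open>nat\<close> exact;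
    \<open>schur\<close> uses k - l - 1 because division by J lowers the degree by one.\<close>
  have Suc: "Suc (nat (k - l - 1)) = nat (k - l)" using kl by simp
  have pow: "w ^ nat (k - l) = w powi (k - l)" for w :: complex
    using kl by (simp add: power_int_def)
  have "jac z * schur k l (sym_map z) = (fst z * snd z) powi l * (fst z powi (k - l) - snd z powi (k - l))"
    using jac_hsum[of z "nat (k - l - 1)"]
    by (simp only: schur_def Suc pow mult.left_commute) (simp add: sym_map_def)
  also have "\<dots> = fst z powi k * snd z powi l - fst z powi l * snd z powi k"
  proof -
    have "w powi k = w powi l * w powi (k - l)" if "w \<noteq> 0" for w :: complex
      using that power_int_add[of w l "k - l"] by simp
    from this[OF nz(1)] this[OF nz(2)] show ?thesis
      by (simp add: power_int_mult_distrib right_diff_distrib mult_ac)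
  qed
  finally show ?thesis by (simp add: chr_def)
qed

lemma measurable_hsum: "hsum n \<in> borel_measurable nu"
proof (induction n rule: less_induct)
  case (less n)
  note [measurable] = coordinates_L_infinity[THEN L_infinity_measurable]
  consider "n = 0" | "n = Suc 0" | m where "n = Suc (Suc m)" by (metis not0_implies_Suc)
  then show ?case
  proof cases
    case 3
    have [measurable]: "hsum m \<in> borel_measurable nu" "hsum (Suc m) \<in> borel_measurable nu"
      using less 3 by auto
    show ?thesis unfolding 3 hsum.simps(3)[abs_def] by measurable
  qed auto
qed

text \<open>J times \<open>schur k l\<close> is a difference of two unimodular functions, so the
  weight |J|^2 keeps the integrand below 4, for negative l as well.\<close>

lemma square_integrable_schur:
  assumes "l < k" shows "square_integrable (schur k l)"
proof -
  note [measurable] = coordinates_L_infinity[THEN L_infinity_measurable] measurable_hsum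
  have m[measurable]: "schur k l \<in> borel_measurable nu"
    unfolding schur_def[abs_def] power_int_def by measurable
  note m' = measurable_nu_compose_sym_map[OF m]
  have "integrable torus_measure (\<lambda>z. (cmod (jac z))\<^sup>2 *\<^sub>R (cmod (schur k l (sym_map z)))\<^sup>2)"
  proof (rule torus.integrable_const_bound[of _ "2\<^sup>2"])
    show "AE z in torus_measure. norm ((cmod (jac z))\<^sup>2 *\<^sub>R (cmod (schur k l (sym_map z)))\<^sup>2) \<le> 2\<^sup>2"
    proof (rule AE_I2)
      fix z assume z: "z \<in> space torus_measure"
      have "cmod (jac z * schur k l (sym_map z)) \<le> 2"
        unfolding jac_schur[OF z assms]
        using norm_triangle_ineq4[of "chr k l z" "chr l k z"] by (simp add: norm_chr[OF z])
      then have "(cmod (jac z * schur k l (sym_map z)))\<^sup>2 \<le> 2\<^sup>2"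
        by (intro power_mono) auto
      then show "norm ((cmod (jac z))\<^sup>2 *\<^sub>R (cmod (schur k l (sym_map z)))\<^sup>2) \<le> 2\<^sup>2"
        by (simp add: norm_mult power_mult_distrib)
    qed
    show "(\<lambda>z. (cmod (jac z))\<^sup>2 *\<^sub>R (cmod (schur k l (sym_map z)))\<^sup>2) \<in> borel_measurable torus_measure"
      using m' by measurable
  qed
  then show ?thesis
    unfolding square_integrable_def using m by (subst integrable_nu_iff) auto
qed

text \<open>U sends it to (\<open>chr k l\<close> - \<open>chr l k\<close>) /
  \<open>jac_norm\<close>. The elements with negative l serve as tests for membership in
  \<open>H2\<close>.\<close>

definition basis :: "int \<Rightarrow> int \<Rightarrow> bGamma_L2" where
  "basis k l = abs_bGamma_L2 (schur k l)"

text \<open>Pairing U f with the antisymmetric image counts the coefficient twice, and 2 /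
  \<open>jac_norm\<close> = \<open>jac_norm\<close>.\<close>

lemma L2_inner_basis:
  assumes kl: "l < k"
  shows "L2_inner f (basis k l) = jac_norm * L2_fourier_coeff f k l"
proof (cases f rule: bGamma_L2_abs_cases)
  case (abs u)
  note sq = square_integrable_schur[OF kl]
  have m: "(\<lambda>x. u x * cnj (schur k l x)) \<in> borel_measurable nu"
    using integrable_mult_cnj[OF abs(1) sq] by simp
  have "(\<integral>x. u x * cnj (schur k l x) \<partial>nu) =
      (\<integral>z. (cmod (jac z))\<^sup>2 *\<^sub>R (u (sym_map z) * cnj (schur k l (sym_map z))) \<partial>torus_measure)"
    by (rule integral_nu[OF m])
  also have "\<dots> = (\<integral>z. jac_norm * (L2_to_torus u z * chr (- k) (- l) z - L2_to_torus u z * chr (- l) (- k) z) \<partial>torus_measure)"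
  proof (rule Bochner_Integration.integral_cong[OF refl])
    fix z assume z: "z \<in> space torus_measure"
    have "(cmod (jac z))\<^sup>2 *\<^sub>R (u (sym_map z) * cnj (schur k l (sym_map z))) =
        jac z * cnj (jac z) * (u (sym_map z) * cnj (schur k l (sym_map z)))"
      by (simp only: scaleR_conv_of_real complex_norm_square)
    also have "\<dots> = jac z * u (sym_map z) * cnj (jac z * schur k l (sym_map z))"
      by simp
    also have "\<dots> = jac z * u (sym_map z) * (chr (- k) (- l) z - chr (- l) (- k) z)"
      by (simp only: jac_schur[OF z kl] complex_cnj_diff cnj_chr[OF z])
    also have "\<dots> = jac_norm * (L2_to_torus u z * chr (- k) (- l) z - L2_to_torus u z * chr (- l) (- k) z)"
      using jac_norm_pos by (simp add: L2_to_torus_def right_diff_distrib)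
    finally show "(cmod (jac z))\<^sup>2 *\<^sub>R (u (sym_map z) * cnj (schur k l (sym_map z))) =
        jac_norm * (L2_to_torus u z * chr (- k) (- l) z - L2_to_torus u z * chr (- l) (- k) z)" .
  qed
  also have "\<dots> = jac_norm * (L2_fourier_coeff f k l - L2_fourier_coeff f l k)"
    using abs by (simp add: L2_fourier_coeff_abs integrable_mult_chr integrable_L2_to_torus)
  also have "L2_fourier_coeff f k l - L2_fourier_coeff f l k = 2 * L2_fourier_coeff f k l"
    using L2_fourier_coeff_swap[of f k l] by simp
  finally show ?thesis
    using abs sq by (simp add: basis_def L2_inner.abs_eq L2_rel_self jac_norm_squared del: of_real_power)
qed


lemma fourier_coeff_mult_chr:
  "fourier_coeff (\<lambda>z. g z * chr i j z) k l = fourier_coeff g (k - i) (l - j)"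
  unfolding fourier_coeff_chr
  by (intro Bochner_Integration.integral_cong refl) (simp add: mult.assoc chr_mult)

text \<open>U turns multiplication by \<open>\<phi>\<close> into multiplication by
  \<open>\<phi> \<circ> sym_map\<close>, and the two characters of the basis element shift its
  coefficients. All information about the symbol is extracted through this formula.\<close>

lemma L2_fourier_coeff_mult_basis:
  assumes \<phi>: "\<phi> \<in> L_infinity" and ij: "j < i"
  shows "L2_fourier_coeff (mult_op \<phi> (basis i j)) k l =
    (fourier_coeff (\<phi> \<circ> sym_map) (k - i) (l - j) - fourier_coeff (\<phi> \<circ> sym_map) (k - j) (l - i)) / jac_norm"
proof -
  note sq = square_integrable_schur[OF ij]
  let ?g = "\<lambda>z. \<phi> (sym_map z)"
  have int: "integrable torus_measure (\<lambda>z. ?g z * chr i' j' z * chr (- k) (- l) z)" for i' j'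
    by (intro integrable_mult_chr L_infinity_integrable \<phi>)
  have "L2_fourier_coeff (mult_op \<phi> (basis i j)) k l =
      (\<integral>z. L2_to_torus (\<lambda>x. \<phi> x * schur i j x) z * chr (- k) (- l) z \<partial>torus_measure)"
    by (simp add: basis_def mult_op_abs \<phi> sq L2_fourier_coeff_abs square_integrable_mult)
  also have "\<dots> = (\<integral>z. (?g z * chr i j z * chr (- k) (- l) z - ?g z * chr j i z * chr (- k) (- l) z) / jac_norm \<partial>torus_measure)"
  proof (rule Bochner_Integration.integral_cong[OF refl])
    fix z assume z: "z \<in> space torus_measure"
    have "L2_to_torus (\<lambda>x. \<phi> x * schur i j x) z = ?g z * (jac z * schur i j (sym_map z)) / jac_norm"
      by (simp add: L2_to_torus_def)
    then show "L2_to_torus (\<lambda>x. \<phi> x * schur i j x) z * chr (- k) (- l) z =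
        (?g z * chr i j z * chr (- k) (- l) z - ?g z * chr j i z * chr (- k) (- l) z) / jac_norm"
      by (simp add: jac_schur[OF z ij] algebra_simps)
  qed
  also have "\<dots> = (fourier_coeff (\<lambda>z. ?g z * chr i j z) k l - fourier_coeff (\<lambda>z. ?g z * chr j i z) k l) / jac_norm"
    using int by (simp add: fourier_coeff_chr)
  finally show ?thesis
    by (simp add: fourier_coeff_mult_chr o_def)
qed

lemma fourier_coeff_sym_map_commute:
  assumes "\<phi> \<in> L_infinity"
  shows "fourier_coeff (\<phi> \<circ> sym_map) j i = fourier_coeff (\<phi> \<circ> sym_map) i j"
proof -
  have "(\<lambda>z. \<phi> (sym_map z)) \<in> borel_measurable torus_measure"
    by (intro measurable_nu_compose_sym_map L_infinity_measurable assms)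
  then have "(\<lambda>z. \<phi> (sym_map z) * chr (- j) (- i) z) \<in> borel_measurable torus_measure"
    by measurable
  from integral_swap[OF this] show ?thesis
    by (simp add: fourier_coeff_chr chr_def sym_map_def mult_ac add.commute)
qed

lemma L2_fourier_coeff_mult_snd:
  "L2_fourier_coeff (mult_op snd f) k l = L2_fourier_coeff f (k - 1) (l - 1)"
proof (cases f rule: bGamma_L2_abs_cases)
  case (abs u)
  have "L2_fourier_coeff (mult_op snd f) k l = (\<integral>z. L2_to_torus (\<lambda>x. snd x * u x) z * chr (- k) (- l) z \<partial>torus_measure)"
    by (simp add: abs mult_op_abs coordinates_L_infinity L2_fourier_coeff_abs square_integrable_mult)
  also have "\<dots> = (\<integral>z. L2_to_torus u z * chr (- (k - 1)) (- (l - 1)) z \<partial>torus_measure)"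
  proof (rule Bochner_Integration.integral_cong[OF refl])
    fix z assume z: "z \<in> space torus_measure"
    have "L2_to_torus (\<lambda>x. snd x * u x) z = L2_to_torus u z * chr 1 1 z"
      by (simp add: L2_to_torus_def sym_map_def chr_def)
    then show "L2_to_torus (\<lambda>x. snd x * u x) z * chr (- k) (- l) z = L2_to_torus u z * chr (- (k - 1)) (- (l - 1)) z"
      by (simp add: mult.assoc chr_mult[OF z])
  qed
  finally show ?thesis using abs by (simp add: L2_fourier_coeff_abs)
qed

lemma L2_fourier_coeff_mult_fst:
  "L2_fourier_coeff (mult_op fst f) k l = L2_fourier_coeff f (k - 1) l + L2_fourier_coeff f k (l - 1)"
proof (cases f rule: bGamma_L2_abs_cases)
  case (abs u)
  have "L2_fourier_coeff (mult_op fst f) k l = (\<integral>z. L2_to_torus (\<lambda>x. fst x * u x) z * chr (- k) (- l) z \<partial>torus_measure)"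
    by (simp add: abs mult_op_abs coordinates_L_infinity L2_fourier_coeff_abs square_integrable_mult)
  also have "\<dots> = (\<integral>z. L2_to_torus u z * chr (- (k - 1)) (- l) z + L2_to_torus u z * chr (- k) (- (l - 1)) z \<partial>torus_measure)"
  proof (rule Bochner_Integration.integral_cong[OF refl])
    fix z assume z: "z \<in> space torus_measure"
    have "L2_to_torus (\<lambda>x. fst x * u x) z = L2_to_torus u z * chr 1 0 z + L2_to_torus u z * chr 0 1 z"
      by (simp add: L2_to_torus_def sym_map_def chr_def algebra_simps)
    then show "L2_to_torus (\<lambda>x. fst x * u x) z * chr (- k) (- l) z =
        L2_to_torus u z * chr (- (k - 1)) (- l) z + L2_to_torus u z * chr (- k) (- (l - 1)) z"
      by (simp add: distrib_right mult.assoc chr_mult[OF z])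
  qed
  finally show ?thesis
    using abs by (simp add: L2_fourier_coeff_abs integrable_mult_chr integrable_L2_to_torus)
qed

text \<open>By antisymmetry it is enough to test indices l < k, and then a forbidden pair has l < 0.
  As an orthogonal complement, \<open>H2\<close> is visibly a closed subspace.\<close>

lemma H2_iff_inner:
  "f \<in> H2 \<longleftrightarrow> (\<forall>k l. l < k \<longrightarrow> l < 0 \<longrightarrow> L2_inner f (basis k l) = 0)"
proof
  assume "\<forall>k l. l < k \<longrightarrow> l < 0 \<longrightarrow> L2_inner f (basis k l) = 0"
  then have *: "L2_fourier_coeff f k l = 0" if "l < k" "l < 0" for k l
    using that jac_norm_pos by (auto simp: L2_inner_basis)
  have "L2_fourier_coeff f i j = 0" if "\<not> (0 \<le> i \<and> 0 \<le> j)" for i j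
  proof -
    consider "j < i" | "i = j" | "i < j" by linarith
    then show ?thesis
    proof cases
      case 1
      with that show ?thesis by (intro *) auto
    next
      case 2
      then show ?thesis by (simp add: L2_fourier_coeff_diag)
    next
      case 3
      with that have "L2_fourier_coeff f j i = 0" by (intro *) auto
      then show ?thesis using L2_fourier_coeff_swap[of f i j] by simp
    qed
  qed
  then show "f \<in> H2" by (simp add: H2_def)
qed (auto simp: H2_def L2_inner_basis)

lemma L2_inner_cscale_right: "L2_inner f (cscale c g) = cnj c * L2_inner f g"
proof -
  have "L2_inner f (cscale c g) = cnj (c * L2_inner g f)"
    by (simp only: L2_inner_commute[of f "cscale c g"] L2_inner_cscale_left)
  also have "\<dots> = cnj c * L2_inner f g"
    by (simp only: L2_inner_commute[of f g] complex_cnj_mult)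
  finally show ?thesis .
qed

text \<open>The real part of the pairing with \<open>cscale \<i> g\<close> is the imaginary part of
  the pairing with g.\<close>

lemma L2_inner_eq_zero_iff: "L2_inner f g = 0 \<longleftrightarrow> f \<bullet> g = 0 \<and> f \<bullet> cscale \<i> g = 0"
  by (simp add: inner_bGamma_L2_def L2_inner_cscale_right complex_eq_iff)

lemma L2_inner_diff_left: "L2_inner (f - g) h = L2_inner f h - L2_inner g h"
  using L2_inner_add_left[of "f - g" g h] by simp

lemma cscale_H2: "f \<in> H2 \<Longrightarrow> cscale c f \<in> H2"
  by (simp add: H2_iff_inner L2_inner_cscale_left)

lemma subspace_H2: "subspace H2"
proof (rule subspaceI)
  show "0 \<in> H2"
    using L2_inner_diff_left[of 0 0] by (simp add: H2_iff_inner)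
next
  fix c :: real and f :: bGamma_L2 assume "f \<in> H2"
  then show "c *\<^sub>R f \<in> H2" by (simp add: scaleR_bGamma_L2_def cscale_H2)
qed (simp add: H2_iff_inner L2_inner_add_left)

lemma closed_H2: "closed H2"
proof -
  have "H2 = (\<Inter>(k, l)\<in>{(k, l). l < k \<and> l < 0}. {f. f \<bullet> basis k l = 0} \<inter> {f. f \<bullet> cscale \<i> (basis k l) = 0})"
    by (auto simp: H2_iff_inner L2_inner_eq_zero_iff)
  also have "closed \<dots>"
    by (intro closed_INT ballI) (auto intro!: closed_Int closed_Collect_eq continuous_intros)
  finally show ?thesis .
qed

text \<open>Real orthogonality to all of \<open>H2\<close> is complex orthogonality, since
  \<open>H2\<close> is invariant under \<open>cscale \<i>\<close>. Two candidates differ by an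
  element of \<open>H2\<close> orthogonal to itself, so the description is proper.\<close>

lemma
  shows orth_proj_H2: "orth_proj H2 f \<in> H2"
    and L2_inner_orth_proj: "h \<in> H2 \<Longrightarrow> L2_inner (f - orth_proj H2 f) h = 0"
proof -
  obtain g where g: "g \<in> H2" "\<And>h. h \<in> H2 \<Longrightarrow> (f - g) \<bullet> h = 0"
    using closed_subspace_projection_exists[OF subspace_H2 closed_H2] by blast
  have g': "L2_inner (f - g) h = 0" if "h \<in> H2" for h
    using g(2) that cscale_H2 by (simp add: L2_inner_eq_zero_iff)
  have "orth_proj H2 f \<in> H2 \<and> (\<forall>h\<in>H2. L2_inner (f - orth_proj H2 f) h = 0)"
    unfolding orth_proj_def
  proof (rule theI[of _ g])
    fix g1 assume g1: "g1 \<in> H2 \<and> (\<forall>h\<in>H2. L2_inner (f - g1) h = 0)"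
    have mem: "g1 - g \<in> H2" using subspace_diff[OF subspace_H2] g1 g(1) by blast
    have "L2_inner (g1 - g) (g1 - g) = L2_inner (f - g) (g1 - g) - L2_inner (f - g1) (g1 - g)"
      by (simp flip: L2_inner_diff_left)
    also have "\<dots> = 0" using g1 g' mem by simp
    finally show "g1 = g" using L2_inner_self_eq_zero[of "g1 - g"] by simp
  qed (use g g' in auto)
  then show "orth_proj H2 f \<in> H2" "h \<in> H2 \<Longrightarrow> L2_inner (f - orth_proj H2 f) h = 0"
    by auto
qed

text \<open>The case of the constant symbol 1, whose only nonzero coefficient sits at the
  origin.\<close>

lemma L2_fourier_coeff_basis:
  assumes "j < i"
  shows "L2_fourier_coeff (basis i j) k l = (of_bool (k = i \<and> l = j) - of_bool (k = j \<and> l = i)) / complex_of_real jac_norm"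
proof -
  have one: "(\<lambda>_. 1) \<in> L_infinity" by (auto simp: L_infinity_def intro!: exI[of _ 1])
  have "mult_op (\<lambda>_. 1) (basis i j) = basis i j"
    by (simp add: basis_def mult_op_abs[OF one] square_integrable_schur[OF assms])
  then have *: "L2_fourier_coeff (basis i j) k l = (fourier_coeff ((\<lambda>_. 1) \<circ> sym_map) (k - i) (l - j)
      - fourier_coeff ((\<lambda>_. 1) \<circ> sym_map) (k - j) (l - i)) / jac_norm"
    using L2_fourier_coeff_mult_basis[OF one assms, of k l] by (simp only:)
  have "fourier_coeff ((\<lambda>_. 1) \<circ> sym_map) m n = of_bool (m = 0 \<and> n = 0)" for m n
    by (simp add: fourier_coeff_chr integral_chr)
  then show ?thesis unfolding * by (simp only: right_minus_eq)
qed

lemma basis_H2: "0 \<le> j \<Longrightarrow> j < i \<Longrightarrow> basis i j \<in> H2"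
  by (auto simp: H2_def L2_fourier_coeff_basis)

text \<open>Within the quadrant, f minus its projection is orthogonal to each
  \<open>basis k l\<close> in \<open>H2\<close>; outside, membership in \<open>H2\<close> forces
  0.\<close>

lemma L2_fourier_coeff_orth_proj:
  "L2_fourier_coeff (orth_proj H2 f) k l = (if 0 \<le> k \<and> 0 \<le> l then L2_fourier_coeff f k l else 0)"
proof (cases "0 \<le> k \<and> 0 \<le> l")
  case False
  then show ?thesis using orth_proj_H2[of f] by (auto simp: H2_def)
next
  case True
  have *: "L2_fourier_coeff (orth_proj H2 f) k l = L2_fourier_coeff f k l" if "0 \<le> l" "l < k" for k l
    using L2_inner_orth_proj[OF basis_H2[OF that], of f] that jac_norm_pos
    by (simp add: L2_inner_basis L2_fourier_coeff_diff)
  consider "l < k" | "k = l" | "k < l" by linarith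
  then show ?thesis
  proof cases
    case 1
    with True show ?thesis by (simp add: *)
  next
    case 2
    then show ?thesis by (simp add: L2_fourier_coeff_diag)
  next
    case 3
    with True have "L2_fourier_coeff (orth_proj H2 f) l k = L2_fourier_coeff f l k"
      by (intro *) auto
    with True show ?thesis
      by (simp add: L2_fourier_coeff_swap[of _ k l])
  qed
qed

lemma L2_eqI: "(\<And>i j. L2_fourier_coeff f i j = L2_fourier_coeff g i j) \<Longrightarrow> f = g"
  using L2_eq_zero[of "f - g"] by (simp add: L2_fourier_coeff_diff)

lemma H2_coeff_zero: "f \<in> H2 \<Longrightarrow> \<not> (0 \<le> i \<and> 0 \<le> j) \<Longrightarrow> L2_fourier_coeff f i j = 0"
  unfolding H2_def by blast

lemma orth_proj_H2_id: "f \<in> H2 \<Longrightarrow> orth_proj H2 f = f"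
  by (rule L2_eqI) (simp add: L2_fourier_coeff_orth_proj H2_coeff_zero)

lemma toeplitz_H2: "toeplitz \<phi> f \<in> H2"
  by (simp add: toeplitz_def orth_proj_H2)

lemma mult_snd_H2: "f \<in> H2 \<Longrightarrow> mult_op snd f \<in> H2"
  by (auto simp: H2_def L2_fourier_coeff_mult_snd)

lemma mult_fst_H2: "f \<in> H2 \<Longrightarrow> mult_op fst f \<in> H2"
  by (auto simp: H2_def L2_fourier_coeff_mult_fst)

text \<open>The hypothesis says that the projection of \<open>g\<close> onto \<open>H2\<close> has no Fourier coefficients. This avoids
  any approximation of \<open>f\<close> by finite combinations of the \<open>basis i j\<close>.\<close>

lemma L2_inner_zero_if_basis:
  assumes "\<And>i j. 0 \<le> j \<Longrightarrow> j < i \<Longrightarrow> L2_inner (basis i j) g = 0" and f: "f \<in> H2"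
  shows "L2_inner f g = 0"
proof -
  have "L2_fourier_coeff g i j = 0" if "0 \<le> i" "0 \<le> j" for i j
  proof -
    have *: "L2_fourier_coeff g i j = 0" if "0 \<le> j" "j < i" for i j
    proof -
      have "L2_inner g (basis i j) = 0"
        by (simp only: L2_inner_commute[of g "basis i j"] assms(1)[OF that] complex_cnj_zero)
      then show ?thesis
        using jac_norm_pos by (simp add: L2_inner_basis[OF that(2)])
    qed
    consider "j < i" | "i = j" | "i < j" by linarith
    then show ?thesis
    proof cases
      case 3
      then have "L2_fourier_coeff g j i = 0" using that by (intro *)
      then show ?thesis by (simp add: L2_fourier_coeff_swap[of g i j])
    qed (use * that in \<open>auto simp: L2_fourier_coeff_diag\<close>)
  qed
  then have "orth_proj H2 g = 0"
    by (intro L2_eq_zero) (simp add: L2_fourier_coeff_orth_proj)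
  then have "L2_inner g f = 0" using L2_inner_orth_proj[OF f, of g] by simp
  then show ?thesis by (simp only: L2_inner_commute[of f g] complex_cnj_zero)
qed

lemma H_infinity_coeff_zero:
  "\<phi> \<in> H_infinity \<Longrightarrow> \<not> (0 \<le> i \<and> 0 \<le> j) \<Longrightarrow> fourier_coeff (\<phi> \<circ> sym_map) i j = 0"
  unfolding H_infinity_def by blast

text \<open>Passing to the adjoint reduces f to basis elements. For l < 0 and i, j nonnegative, both
  symbol coefficients that occur have a negative second index.\<close>

lemma mult_H_infinity_H2:
  assumes \<phi>: "\<phi> \<in> H_infinity" and f: "f \<in> H2"
  shows "mult_op \<phi> f \<in> H2"
proof -
  have L: "\<phi> \<in> L_infinity" using \<phi> by (simp add: H_infinity_def)
  have "L2_inner (mult_op \<phi> f) (basis k l) = 0" if kl: "l < k" "l < 0" for k l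
    unfolding mult_op_adjoint[OF L]
  proof (rule L2_inner_zero_if_basis[OF _ f])
    fix i j :: int assume ij: "0 \<le> j" "j < i"
    have zero: "fourier_coeff (\<phi> \<circ> sym_map) (k - i) (l - j) = 0" "fourier_coeff (\<phi> \<circ> sym_map) (k - j) (l - i) = 0"
      using ij kl by (intro H_infinity_coeff_zero \<phi>; linarith)+
    have "L2_inner (basis i j) (mult_op (\<lambda>x. cnj (\<phi> x)) (basis k l)) =
        L2_inner (mult_op \<phi> (basis i j)) (basis k l)"
      by (rule mult_op_adjoint[OF L, symmetric])
    also have "\<dots> = 0"
      by (simp only: L2_inner_basis[OF kl(1)] L2_fourier_coeff_mult_basis[OF L ij(2)] zero) simp
    finally show "L2_inner (basis i j) (mult_op (\<lambda>x. cnj (\<phi> x)) (basis k l)) = 0" .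
  qed
  then show ?thesis by (simp add: H2_iff_inner)
qed

section \<open>Toeplitz operators\<close>

text \<open>Fourier coefficients of a bounded function are square summable, so a value taken
  infinitely often along an antidiagonal is 0.\<close>

lemma bessel_antidiagonal:
  assumes \<phi>: "\<phi> \<in> L_infinity"
    and const: "\<And>t. t \<ge> t0 \<Longrightarrow> fourier_coeff (\<phi> \<circ> sym_map) (m + t) (n - t) = \<alpha>"
  shows "\<alpha> = 0"
proof (rule ccontr)
  assume "\<alpha> \<noteq> 0"
  define \<Phi> where "\<Phi> z = \<phi> (sym_map z)" for z
  obtain C where C: "AE z in torus_measure. cmod (\<Phi> z) \<le> C"
    unfolding \<Phi>_def using \<phi> by (rule L_infinity_bounded)
  have \<Phi>m[measurable]: "\<Phi> \<in> borel_measurable torus_measure"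
    unfolding \<Phi>_def by (intro measurable_nu_compose_sym_map L_infinity_measurable \<phi>)
  have \<Phi>i: "integrable torus_measure \<Phi>"
    unfolding \<Phi>_def by (rule L_infinity_integrable[OF \<phi>])
  define P where "P = (\<integral>z. (cmod (\<Phi> z))\<^sup>2 \<partial>torus_measure)"
  have Pi: "integrable torus_measure (\<lambda>z. (cmod (\<Phi> z))\<^sup>2)"
  proof (rule torus.integrable_const_bound[of _ "C\<^sup>2"])
    show "AE z in torus_measure. norm ((cmod (\<Phi> z))\<^sup>2) \<le> C\<^sup>2"
      using C by eventually_elim (simp add: power_mono)
  qed simp
  \<comment> \<open>N is chosen against Bessel's inequality: the N characters summed in
    \<open>S\<close> are distinct, hence orthonormal, which would bound N |\<alpha>|^2 by P.\<close>
  obtain N :: nat where N: "real N * (cmod \<alpha>)\<^sup>2 > P"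
    using \<open>\<alpha> \<noteq> 0\<close> reals_Archimedean3[of "(cmod \<alpha>)\<^sup>2"] by auto
  define A where "A = {t0..<t0 + int N}"
  have A: "finite A" "card A = N" by (simp_all add: A_def)
  define S where "S z = (\<Sum>t\<in>A. chr (m + t) (n - t) z)" for z
  have Sm[measurable]: "S \<in> borel_measurable torus_measure"
    unfolding S_def by measurable
  have chr_int: "integrable torus_measure (chr i j)" for i j
    by (rule torus.integrable_const_bound[of _ 1]) (auto simp: norm_chr)
  have cnjS: "cnj (S z) = (\<Sum>t\<in>A. chr (- (m + t)) (- (n - t)) z)" if "z \<in> space torus_measure" for z
    unfolding S_def cnj_sum using that by (intro sum.cong refl cnj_chr)
  have \<Phi>S_eq: "\<Phi> z * cnj (S z) = (\<Sum>t\<in>A. \<Phi> z * chr (- (m + t)) (- (n - t)) z)" if "z \<in> space torus_measure" for z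
    by (simp only: cnjS[OF that] sum_distrib_left)
  have \<Phi>Si: "integrable torus_measure (\<lambda>z. \<Phi> z * cnj (S z))"
    by (rule iffD2[OF Bochner_Integration.integrable_cong[OF refl \<Phi>S_eq]], assumption)
      (intro Bochner_Integration.integrable_sum integrable_mult_chr \<Phi>i)
  have "(\<integral>z. \<Phi> z * cnj (S z) \<partial>torus_measure) = (\<integral>z. (\<Sum>t\<in>A. \<Phi> z * chr (- (m + t)) (- (n - t)) z) \<partial>torus_measure)"
    by (rule Bochner_Integration.integral_cong[OF refl \<Phi>S_eq])
  also have "\<dots> = (\<Sum>t\<in>A. \<integral>z. \<Phi> z * chr (- (m + t)) (- (n - t)) z \<partial>torus_measure)"
    by (intro Bochner_Integration.integral_sum integrable_mult_chr \<Phi>i)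
  also have "\<dots> = (\<Sum>t\<in>A. \<alpha>)"
  proof (rule sum.cong[OF refl])
    fix t assume "t \<in> A"
    then have "fourier_coeff (\<phi> \<circ> sym_map) (m + t) (n - t) = \<alpha>" by (intro const) (simp add: A_def)
    then show "(\<integral>z. \<Phi> z * chr (- (m + t)) (- (n - t)) z \<partial>torus_measure) = \<alpha>"
      by (simp only: fourier_coeff_chr o_def \<Phi>_def)
  qed
  finally have \<Phi>S: "(\<integral>z. \<Phi> z * cnj (S z) \<partial>torus_measure) = of_nat N * \<alpha>" using A by simp
  have SS_eq: "of_real ((cmod (S z))\<^sup>2) = (\<Sum>t\<in>A. \<Sum>u\<in>A. chr (t - u) (u - t) z)" if z: "z \<in> space torus_measure" for z
  proof -
    have "of_real ((cmod (S z))\<^sup>2) = S z * cnj (S z)" by (rule complex_norm_square)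
    also have "\<dots> = (\<Sum>t\<in>A. \<Sum>u\<in>A. chr (m + t) (n - t) z * chr (- (m + u)) (- (n - u)) z)"
      unfolding cnjS[OF z] unfolding S_def by (rule sum_product)
    also have "\<dots> = (\<Sum>t\<in>A. \<Sum>u\<in>A. chr (t - u) (u - t) z)"
      by (intro sum.cong refl) (simp add: chr_mult[OF z])
    finally show ?thesis .
  qed
  have SSi: "integrable torus_measure (\<lambda>z. complex_of_real ((cmod (S z))\<^sup>2))"
    by (rule iffD2[OF Bochner_Integration.integrable_cong[OF refl SS_eq]], assumption)
      (intro Bochner_Integration.integrable_sum chr_int)
  have "(\<integral>z. complex_of_real ((cmod (S z))\<^sup>2) \<partial>torus_measure) = (\<integral>z. (\<Sum>t\<in>A. \<Sum>u\<in>A. chr (t - u) (u - t) z) \<partial>torus_measure)"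
    by (rule Bochner_Integration.integral_cong[OF refl SS_eq])
  also have "\<dots> = (\<Sum>t\<in>A. \<Sum>u\<in>A. \<integral>z. chr (t - u) (u - t) z \<partial>torus_measure)"
    by (simp add: Bochner_Integration.integral_sum chr_int)
  also have "\<dots> = (\<Sum>t\<in>A. \<Sum>u\<in>A. if t = u then 1 else 0)"
    by (intro sum.cong refl) (simp add: integral_chr)
  also have "\<dots> = of_nat N" using A by simp
  finally have SS: "(\<integral>z. complex_of_real ((cmod (S z))\<^sup>2) \<partial>torus_measure) = of_nat N" .
  \<comment> \<open>Bessel's inequality: integrate $|\Phi - \alpha S|^2 \ge 0$, where $S$ is a sum of $N$ characters\<close>
  have expand: "complex_of_real ((cmod (\<Phi> z - \<alpha> * S z))\<^sup>2) = of_real ((cmod (\<Phi> z))\<^sup>2)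
      - cnj \<alpha> * (\<Phi> z * cnj (S z)) - \<alpha> * cnj (\<Phi> z * cnj (S z)) + of_real ((cmod \<alpha>)\<^sup>2) * of_real ((cmod (S z))\<^sup>2)" for z
    unfolding complex_norm_square by (simp add: algebra_simps)
  have "complex_of_real (\<integral>z. (cmod (\<Phi> z - \<alpha> * S z))\<^sup>2 \<partial>torus_measure) =
      (\<integral>z. complex_of_real ((cmod (\<Phi> z - \<alpha> * S z))\<^sup>2) \<partial>torus_measure)"
    by (rule integral_complex_of_real[symmetric])
  also have "\<dots> = of_real P - cnj \<alpha> * (\<integral>z. \<Phi> z * cnj (S z) \<partial>torus_measure)
      - \<alpha> * cnj (\<integral>z. \<Phi> z * cnj (S z) \<partial>torus_measure)
      + of_real ((cmod \<alpha>)\<^sup>2) * (\<integral>z. complex_of_real ((cmod (S z))\<^sup>2) \<partial>torus_measure)"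
  proof -
    have int1: "integrable torus_measure (\<lambda>z. complex_of_real ((cmod (\<Phi> z))\<^sup>2))"
      using Pi by (rule integrable_of_real)
    have int2: "integrable torus_measure (\<lambda>z. cnj \<alpha> * (\<Phi> z * cnj (S z)))"
      using \<Phi>Si by (rule integrable_mult_right)
    have int3: "integrable torus_measure (\<lambda>z. \<alpha> * cnj (\<Phi> z * cnj (S z)))"
      using \<Phi>Si by (intro integrable_mult_right integrable_cnj)
    have int4: "integrable torus_measure (\<lambda>z. of_real ((cmod \<alpha>)\<^sup>2) * complex_of_real ((cmod (S z))\<^sup>2))"
      using SSi by (rule integrable_mult_right)
    show ?thesis
      unfolding expand P_def integral_complex_of_real[symmetric]
        Bochner_Integration.integral_add[OF Bochner_Integration.integrable_diff[OF Bochner_Integration.integrable_diff[OF int1 int2] int3] int4]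
        Bochner_Integration.integral_diff[OF Bochner_Integration.integrable_diff[OF int1 int2] int3]
        Bochner_Integration.integral_diff[OF int1 int2]
        integral_mult_right_zero Bochner_Integration.integral_cnj ..
  qed
  also have "\<dots> = of_real (P - real N * (cmod \<alpha>)\<^sup>2)"
    unfolding \<Phi>S SS
    unfolding of_real_diff of_real_mult complex_norm_square of_real_of_nat_eq
    by (simp add: algebra_simps)
  finally have "(\<integral>z. (cmod (\<Phi> z - \<alpha> * S z))\<^sup>2 \<partial>torus_measure) = P - real N * (cmod \<alpha>)\<^sup>2"
    by (simp only: of_real_eq_iff)
  moreover have "0 \<le> (\<integral>z. (cmod (\<Phi> z - \<alpha> * S z))\<^sup>2 \<partial>torus_measure)" by simp
  ultimately show False using N by simp
qed

lemma H_infinity_if_coeff_zero: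
  assumes \<phi>: "\<phi> \<in> L_infinity"
    and zero: "\<And>i j k. 0 \<le> j \<Longrightarrow> j < i \<Longrightarrow> 0 < k \<Longrightarrow> L2_fourier_coeff (mult_op \<phi> (basis i j)) k (- 1) = 0"
  shows "\<phi> \<in> H_infinity"
proof -
  define a where "a = fourier_coeff (\<phi> \<circ> sym_map)"
  have step: "a (k - i) (- 1 - j) = a (k - j) (- 1 - i)" if "0 \<le> j" "j < i" "0 < k" for i j k
    using zero[OF that] jac_norm_pos unfolding L2_fourier_coeff_mult_basis[OF \<phi> that(2)] a_def by simp
  have neg: "a m n = 0" if "n < 0" for m n
  proof (rule bessel_antidiagonal[OF \<phi>])
    \<comment> \<open>With j = -1 - n, i = j + t and k = m + i the relation \<open>step\<close>
      compares (m,n) with (m+t,n-t). It needs t \<ge> 1 for j < i and t \<ge> 2 + n - m for 0 <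
      k.\<close>
    fix t assume t: "max 1 (2 + n - m) \<le> t"
    then have "a (m + t) (n - t) = a m n"
      using step[of "- 1 - n" "- 1 - n + t" "m + (- 1 - n + t)"] that by (simp add: algebra_simps)
    then show "fourier_coeff (\<phi> \<circ> sym_map) (m + t) (n - t) = a m n" by (simp add: a_def)
  qed
  have "a i j = 0" if "\<not> (0 \<le> i \<and> 0 \<le> j)" for i j
  proof (cases "j < 0")
    case False
    with that have "a j i = 0" by (intro neg) simp
    then show ?thesis by (simp add: a_def fourier_coeff_sym_map_commute[OF \<phi>, of j i])
  qed (rule neg)
  then show ?thesis
    using \<phi> unfolding H_infinity_def a_def by blast
qed

text \<open>The strict interior of the quadrant already determines a symbol. Row 0 is kept out of
  the hypothesis because that is where a product of Toeplitz operators may deviate.\<close>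

lemma toeplitz_symbol_zero:
  assumes \<delta>: "\<delta> \<in> L_infinity"
    and zero: "\<And>i j k l. 0 \<le> j \<Longrightarrow> j < i \<Longrightarrow> 0 < l \<Longrightarrow> l < k \<Longrightarrow>
      L2_fourier_coeff (mult_op \<delta> (basis i j)) k l = 0"
  shows "fourier_coeff (\<delta> \<circ> sym_map) m n = 0"
proof (rule bessel_antidiagonal[OF \<delta>])
  fix t assume t: "max 1 (1 + n - m) \<le> t"
  \<comment> \<open>Large enough that j \<ge> 0 and that the row n + j is positive; the bound on t
    then gives j < i and l < k for i = j + t, k = m + i, l = n + j.\<close>
  define j where "j = max 0 (1 - n)"
  have "fourier_coeff (\<delta> \<circ> sym_map) (m + (j + t) - (j + t)) (n + j - j) =
      fourier_coeff (\<delta> \<circ> sym_map) (m + (j + t) - j) (n + j - (j + t))"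
  proof -
    have "j < j + t" using t by simp
    moreover have "L2_fourier_coeff (mult_op \<delta> (basis (j + t) j)) (m + (j + t)) (n + j) = 0"
      using t by (intro zero) (auto simp: j_def)
    ultimately show ?thesis
      using jac_norm_pos by (simp only: L2_fourier_coeff_mult_basis[OF \<delta>]) simp
  qed
  then show "fourier_coeff (\<delta> \<circ> sym_map) (m + t) (n - t) = fourier_coeff (\<delta> \<circ> sym_map) m n"
    by (simp add: algebra_simps)
qed

section \<open>The two directions of the equivalences\<close>

lemma L2_fourier_coeff_toeplitz:
  "L2_fourier_coeff (toeplitz \<phi> f) k l = (if 0 \<le> k \<and> 0 \<le> l then L2_fourier_coeff (mult_op \<phi> f) k l else 0)"
  by (simp add: toeplitz_def L2_fourier_coeff_orth_proj)

lemma toeplitz_eq_mult: "mult_op \<phi> f \<in> H2 \<Longrightarrow> toeplitz \<phi> f = mult_op \<phi> f"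
  by (simp add: toeplitz_def orth_proj_H2_id)

lemma T_s_eq: "f \<in> H2 \<Longrightarrow> T_s f = mult_op fst f"
  and T_p_eq: "f \<in> H2 \<Longrightarrow> T_p f = mult_op snd f"
  by (simp_all add: toeplitz_eq_mult mult_fst_H2 mult_snd_H2)

text \<open>Neither projection truncates anything, so the product is multiplication by the product
  of the symbols.\<close>

lemma is_toeplitz_analytic:
  assumes \<phi>: "\<phi> \<in> H_infinity" and q: "q \<in> L_infinity" "\<And>f. f \<in> H2 \<Longrightarrow> mult_op q f \<in> H2"
  shows "is_toeplitz (toeplitz q \<circ> toeplitz \<phi>)"
proof -
  have L: "\<phi> \<in> L_infinity" using \<phi> by (simp add: H_infinity_def)
  have "(toeplitz q \<circ> toeplitz \<phi>) f = toeplitz (\<lambda>x. q x * \<phi> x) f" if "f \<in> H2" for f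
    using mult_H_infinity_H2[OF \<phi> that] q(2) mult_op_mult[OF q(1) L, of f]
    by (simp add: toeplitz_eq_mult)
  then show ?thesis
    unfolding is_toeplitz_def using L_infinity_mult[OF q(1) L] by blast
qed

lemma commute_analytic:
  assumes \<phi>: "\<phi> \<in> H_infinity" and q: "q \<in> L_infinity" "\<And>f. f \<in> H2 \<Longrightarrow> mult_op q f \<in> H2"
  shows "commute_on_H2 (toeplitz \<phi>) (toeplitz q)"
proof -
  have L: "\<phi> \<in> L_infinity" using \<phi> by (simp add: H_infinity_def)
  show ?thesis
    unfolding commute_on_H2_def
    using mult_H_infinity_H2[OF \<phi>] q(2) mult_op_commute[OF L q(1)]
    by (simp add: toeplitz_eq_mult)
qed

text \<open>On the row $l = 0$ the product $T_q T_\varphi$ differs from multiplication by $q\varphi$ exactly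
  by the coefficients of $\varphi f$ on the row $-1$, moved by the offset \<open>d\<close>, which is 1 for
  $q = p$ and 0 for $q = s$.\<close>

lemma H_infinity_if_toeplitz_product:
  assumes \<phi>: "\<phi> \<in> L_infinity" and q: "q \<in> L_infinity"
    and T: "is_toeplitz (toeplitz q \<circ> toeplitz \<phi>)"
    and q_H2: "\<And>f. f \<in> H2 \<Longrightarrow> mult_op q f \<in> H2"
    and interior: "\<And>f k l. 0 < l \<Longrightarrow> l < k \<Longrightarrow>
      L2_fourier_coeff (mult_op q (toeplitz \<phi> f)) k l = L2_fourier_coeff (mult_op q (mult_op \<phi> f)) k l"
    and boundary: "\<And>f k. 0 < k \<Longrightarrow>
      L2_fourier_coeff (mult_op q (mult_op \<phi> f)) (k + d) 0 - L2_fourier_coeff (mult_op q (toeplitz \<phi> f)) (k + d) 0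
      = L2_fourier_coeff (mult_op \<phi> f) k (- 1)"
    and d: "0 \<le> d"
  shows "\<phi> \<in> H_infinity"
proof -
  obtain \<psi> where \<psi>: "\<psi> \<in> L_infinity" "\<And>f. f \<in> H2 \<Longrightarrow> toeplitz q (toeplitz \<phi> f) = toeplitz \<psi> f"
    using T by (auto simp: is_toeplitz_def)
  \<comment> \<open>The deviation of the given symbol \<open>\<psi>\<close> from the expected one;
    the interior coefficients will show that it has no Fourier coefficients.\<close>
  define \<delta> where "\<delta> x = \<psi> x - q x * \<phi> x" for x
  have \<delta>: "\<delta> \<in> L_infinity"
    unfolding \<delta>_def by (intro L_infinity_diff L_infinity_mult \<phi> q \<psi>)
  have mult_\<delta>: "mult_op \<delta> f = mult_op \<psi> f - mult_op q (mult_op \<phi> f)" for f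
    unfolding \<delta>_def
    by (simp only: mult_op_diff[OF \<psi>(1) L_infinity_mult[OF q \<phi>]] mult_op_mult[OF q \<phi>])
  have coeff: "L2_fourier_coeff (mult_op \<psi> f) k l = L2_fourier_coeff (mult_op q (toeplitz \<phi> f)) k l"
    if "f \<in> H2" "0 \<le> k" "0 \<le> l" for f k l
  proof -
    have "mult_op q (toeplitz \<phi> f) = toeplitz \<psi> f"
      using \<psi>(2)[OF that(1)] by (simp add: toeplitz_eq_mult q_H2 toeplitz_H2)
    then show ?thesis using that by (simp add: L2_fourier_coeff_toeplitz)
  qed
  have \<delta>_zero: "fourier_coeff (\<delta> \<circ> sym_map) m n = 0" for m n
  proof (rule toeplitz_symbol_zero[OF \<delta>])
    fix i j k l :: int assume "0 \<le> j" "j < i" "0 < l" "l < k"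
    then show "L2_fourier_coeff (mult_op \<delta> (basis i j)) k l = 0"
      by (simp add: mult_\<delta> L2_fourier_coeff_diff coeff basis_H2 interior)
  qed
  show ?thesis
  proof (rule H_infinity_if_coeff_zero[OF \<phi>])
    fix i j k :: int assume ij: "0 \<le> j" "j < i" and k: "0 < k"
    \<comment> \<open>With the symbol identified, row 0 can be compared as well, and there the
      truncation inside \<open>toeplitz \<phi>\<close> becomes visible.\<close>
    have "L2_fourier_coeff (mult_op \<delta> (basis i j)) (k + d) 0 = 0"
      by (simp only: L2_fourier_coeff_mult_basis[OF \<delta> ij(2)] \<delta>_zero) simp
    then have "L2_fourier_coeff (mult_op q (toeplitz \<phi> (basis i j))) (k + d) 0 =
        L2_fourier_coeff (mult_op q (mult_op \<phi> (basis i j))) (k + d) 0"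
      using ij k d by (simp add: mult_\<delta> L2_fourier_coeff_diff coeff basis_H2)
    then show "L2_fourier_coeff (mult_op \<phi> (basis i j)) k (- 1) = 0"
      using boundary[OF k, of "basis i j"] by simp
  qed
qed

text \<open>The range of T_p is p \<open>H2\<close>, whose elements have nothing in row 0. The row 0
  of T_\<phi> applied to p \<open>basis i j\<close> is the row -1 of \<open>\<phi>\<close> times
  \<open>basis i j\<close>, moved by (1,1).\<close>

lemma H_infinity_if_range_T_p_invariant:
  assumes \<phi>: "\<phi> \<in> L_infinity" and inv: "toeplitz \<phi> ` (T_p ` H2) \<subseteq> T_p ` H2"
  shows "\<phi> \<in> H_infinity"
proof (rule H_infinity_if_coeff_zero[OF \<phi>])
  fix i j k :: int assume ij: "0 \<le> j" "j < i" and k: "0 < k"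
  have b: "basis i j \<in> H2" using ij by (rule basis_H2)
  then have "toeplitz \<phi> (mult_op snd (basis i j)) \<in> T_p ` H2"
    using inv imageI[OF imageI[OF b, of T_p], of "toeplitz \<phi>"] by (auto simp: T_p_eq)
  then obtain g where g: "g \<in> H2" "toeplitz \<phi> (mult_op snd (basis i j)) = mult_op snd g"
    by (auto simp: T_p_eq)
  have "L2_fourier_coeff (mult_op \<phi> (basis i j)) k (- 1) =
      L2_fourier_coeff (mult_op \<phi> (mult_op snd (basis i j))) (k + 1) 0"
    by (simp add: mult_op_commute[OF \<phi> coordinates_L_infinity(2)] L2_fourier_coeff_mult_snd)
  also have "\<dots> = L2_fourier_coeff (toeplitz \<phi> (mult_op snd (basis i j))) (k + 1) 0"
    using k by (simp add: L2_fourier_coeff_toeplitz)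
  also have "\<dots> = L2_fourier_coeff g k (- 1)"
    unfolding g(2) by (simp add: L2_fourier_coeff_mult_snd)
  also have "\<dots> = 0" using g(1) by (simp add: H2_coeff_zero)
  finally show "L2_fourier_coeff (mult_op \<phi> (basis i j)) k (- 1) = 0" .
qed

text \<open>At (k,0) with k > 0 both orders contain the coefficient of \<open>\<phi>\<close> times
  \<open>basis i j\<close> at (k-1,0); only the order in which s acts before the truncation also
  contains the one at (k,-1).\<close>

lemma H_infinity_if_commute_T_s:
  assumes \<phi>: "\<phi> \<in> L_infinity" and comm: "commute_on_H2 (toeplitz \<phi>) T_s"
  shows "\<phi> \<in> H_infinity"
proof (rule H_infinity_if_coeff_zero[OF \<phi>])
  fix i j k :: int assume ij: "0 \<le> j" "j < i" and k: "0 < k"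
  have b: "basis i j \<in> H2" using ij by (rule basis_H2)
  have "toeplitz \<phi> (mult_op fst (basis i j)) = mult_op fst (toeplitz \<phi> (basis i j))"
    using comm b by (simp add: commute_on_H2_def T_s_eq toeplitz_H2)
  then have "L2_fourier_coeff (toeplitz \<phi> (mult_op fst (basis i j))) k 0 =
      L2_fourier_coeff (mult_op fst (toeplitz \<phi> (basis i j))) k 0"
    by simp
  then show "L2_fourier_coeff (mult_op \<phi> (basis i j)) k (- 1) = 0"
    using k by (simp add: L2_fourier_coeff_toeplitz L2_fourier_coeff_mult_fst
        mult_op_commute[OF \<phi> coordinates_L_infinity(1)])
qed

theorem theorem3:
  fixes \<phi> :: "complex \<times> complex \<Rightarrow> complex"
  assumes "\<phi> \<in> L_infinity"
  shows "(\<phi> \<in> H_infinity \<longleftrightarrow> commute_on_H2 (toeplitz \<phi>) T_p)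
       \<and> (\<phi> \<in> H_infinity \<longleftrightarrow> toeplitz \<phi> ` (T_p ` H2) \<subseteq> T_p ` H2)
       \<and> (\<phi> \<in> H_infinity \<longleftrightarrow> is_toeplitz (T_p \<circ> toeplitz \<phi>))
       \<and> (\<phi> \<in> H_infinity \<longleftrightarrow> commute_on_H2 (toeplitz \<phi>) T_s)
       \<and> (\<phi> \<in> H_infinity \<longleftrightarrow> is_toeplitz (T_s \<circ> toeplitz \<phi>))"
proof -
  note s = coordinates_L_infinity(1) and p = coordinates_L_infinity(2)
  \<comment> \<open>Commuting rewrites T_\<phi> T_p f as T_p applied to T_\<phi> f, which lies in
    \<open>H2\<close>; so the condition on T_p is reduced to invariance of its range.\<close>
  have inv: "toeplitz \<phi> ` (T_p ` H2) \<subseteq> T_p ` H2" if "commute_on_H2 (toeplitz \<phi>) T_p"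
    using that toeplitz_H2 unfolding commute_on_H2_def by (auto intro!: imageI)
  have iv: "\<phi> \<in> H_infinity" if "is_toeplitz (T_p \<circ> toeplitz \<phi>)"
    using that
    by (intro H_infinity_if_toeplitz_product[OF assms p, where d = 1])
      (auto simp: mult_snd_H2 L2_fourier_coeff_mult_snd L2_fourier_coeff_toeplitz)
  have vi: "\<phi> \<in> H_infinity" if "is_toeplitz (T_s \<circ> toeplitz \<phi>)"
    using that
    by (intro H_infinity_if_toeplitz_product[OF assms s, where d = 0])
      (auto simp: mult_fst_H2 L2_fourier_coeff_mult_fst L2_fourier_coeff_toeplitz)
  show ?thesis
    using commute_analytic[OF _ p mult_snd_H2] commute_analytic[OF _ s mult_fst_H2]
      is_toeplitz_analytic[OF _ p mult_snd_H2] is_toeplitz_analytic[OF _ s mult_fst_H2]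
      H_infinity_if_range_T_p_invariant[OF assms] H_infinity_if_commute_T_s[OF assms] inv iv vi
    by metis
qed

end
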